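(* There exists a recursive coloring function $c:\mathbb{N}\rightarrow \{0,1\}$ such that for every infinite $\Pi^0_3$ set $A\subseteq\mathbb{Z}^+$ with weak apartness, there exist $w_1,w_2\in FS(A)$ with $c(w_1)\neq c(w_2)$.
   Context: For $x=\sum_{i=0}^{k}2^{n_i}\in\mathbb{Z}^+$ with $n_0<\cdots<n_k$, set $\mu(x)=n_k$ and $\lambda(x)=n_0$. For each $n$, $B^n=\{x\in\mathbb{Z}^+:\mu(x)=n\}$. A set $A$ has weak apartness if for every natural number $m$, $B^m\cap A$ has at most one element, and for every natural number $l$, there are at most two $x\in A$ with $\lambda(x)=l$. $FS(A)=\{\sum_{x\in F}x : F\subseteq A,\ F \text{ finite and nonempty}\}$. *)

theory Defs
  imports Main
begin

datatype recf =
    Zf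
  | Sf
  | Pf nat
  | Cf recf "recf list"
  | Rf recf recf
  | Mf recf

inductive reval :: "recf \<Rightarrow> nat list \<Rightarrow> nat \<Rightarrow> bool" where
  zero: "reval Zf xs 0"
| succ: "reval Sf (x # xs) (Suc x)"
| proj: "i < length xs \<Longrightarrow> reval (Pf i) xs (xs ! i)"
| comp: "list_all2 (\<lambda>g y. reval g xs y) gs ys \<Longrightarrow> reval f ys z \<Longrightarrow> reval (Cf f gs) xs z"
| prim0: "reval f xs y \<Longrightarrow> reval (Rf f g) (0 # xs) y"
| primS: "reval (Rf f g) (n # xs) y \<Longrightarrow> reval g (n # y # xs) z \<Longrightarrow> reval (Rf f g) (Suc n # xs) z"
| mini: "reval f (n # xs) 0 \<Longrightarrow> (\<forall>m<n. \<exists>y. reval f (m # xs) y \<and> y > 0) \<Longrightarrow> reval (Mf f) xs n"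

definition recursive_fun :: "(nat \<Rightarrow> nat) \<Rightarrow> bool" where
  "recursive_fun c \<longleftrightarrow> (\<exists>F. \<forall>x. reval F [x] (c x))"

definition recursive_rel4 :: "(nat \<Rightarrow> nat \<Rightarrow> nat \<Rightarrow> nat \<Rightarrow> bool) \<Rightarrow> bool" where
  "recursive_rel4 R \<longleftrightarrow>
     (\<exists>F. \<forall>x a b d. reval F [x, a, b, d] (if R x a b d then 1 else 0))"

definition Pi03 :: "nat set \<Rightarrow> bool" where
  "Pi03 A \<longleftrightarrow> (\<exists>R. recursive_rel4 R \<and> (\<forall>x. x \<in> A \<longleftrightarrow> (\<forall>a. \<exists>b. \<forall>d. R x a b d)))"

definition mu :: "nat \<Rightarrow> nat" where
  "mu x = Max {n. bit x n}"

definition lam :: "nat \<Rightarrow> nat" where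
  "lam x = Min {n. bit x n}"

definition weak_apart :: "nat set \<Rightarrow> bool" where
  "weak_apart A \<longleftrightarrow>
     (\<forall>m. \<forall>x\<in>A. \<forall>y\<in>A. mu x = m \<and> mu y = m \<longrightarrow> x = y) \<and>
     (\<forall>l. finite {x\<in>A. lam x = l} \<and> card {x\<in>A. lam x = l} \<le> 2)"

definition FS :: "nat set \<Rightarrow> nat set" where
  "FS A = {\<Sum>F | F. F \<subseteq> A \<and> finite F \<and> F \<noteq> {}}"

end

theory Submission
  imports Defs "HOL-Library.Nat_Bijection"
begin

text \<open>
  Colour \<open>w\<close> by the parity of its charged gaps, where a gap \<open>(a, b)\<close> is a pair of consecutive
  binary digits and whether it is charged depends only on \<open>a\<close>, \<open>b\<close>, \<open>l = \<lambda>(w)\<close> and \<open>t = \<mu>(w)\<close>.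
  If \<open>\<kappa>, \<sigma>, \<tau>, \<rho>\<close> in \<open>A\<close> have successively higher digits, then the parities of
  \<open>\<kappa> + \<sigma> + \<tau> + \<rho>\<close> and \<open>\<kappa> + \<tau> + \<rho>\<close> differ by those of the gaps inside \<open>\<sigma>\<close> and of the three gaps
  \<open>(\<mu> \<kappa>, \<lambda> \<sigma>)\<close>, \<open>(\<mu> \<sigma>, \<lambda> \<tau>)\<close>, \<open>(\<mu> \<kappa>, \<lambda> \<tau>)\<close>; so it suffices that \<open>(\<mu> \<sigma>, \<lambda> \<tau>)\<close> is charged
  exactly when \<open>\<sigma>\<close> itself has an even number of charged gaps, and that the other two gaps agree
  (pigeonhole among three candidates).

  At a gap \<open>(a, b)\<close> with \<open>a = \<mu> \<sigma>\<close> the colouring must therefore guess which set \<open>A\<close> is to be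
  defeated and which \<open>\<sigma>\<close> lies in \<open>A \<inter> B\<^sup>a\<close>. For \<open>A = {x. \<forall>i. \<exists>j. \<forall>d. R x i j d}\<close> the statement that
  \<open>x\<close> survives the first \<open>i\<close> conditions is a double limit in \<open>t\<close> and then in \<open>b\<close>. Since
  \<open>A \<inter> B\<^sup>a\<close> has at most one element, all other elements of the finite set \<open>B\<^sup>a\<close> die at a finite
  stage, which identifies \<open>\<sigma>\<close> in that limit. The index of \<open>A\<close> is read off \<open>l\<close>: with \<open>a\<close> as stage, the
  indices \<open>e = 0, 1, 2, \<dots>\<close> in turn claim \<open>\<lambda>(x)\<close> for the least surviving \<open>x\<close> whose \<open>\<lambda>(x)\<close> is not yet
  claimed. The smaller indices block at most \<open>e\<close> values, so for large \<open>a\<close> the claim of \<open>e\<close> is among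
  finitely many \<open>\<lambda>(x)\<close> with \<open>x \<in> A\<close>, and one of them occurs for infinitely many \<open>\<sigma> \<in> A\<close>; take \<open>\<kappa> = x\<close>.
\<close>

subsection \<open>A calculus of recursive functions on encoded types\<close>

lemma reval_comp1:
  "reval g xs y \<Longrightarrow> reval f [y] z \<Longrightarrow> reval (Cf f [g]) xs z"
  by (rule reval.comp[where ys = "[y]"]) auto

lemma reval_comp2:
  "reval g xs y \<Longrightarrow> reval h xs y' \<Longrightarrow> reval f [y, y'] z \<Longrightarrow> reval (Cf f [g, h]) xs z"
  by (rule reval.comp[where ys = "[y, y']"]) auto

lemma reval_proj0: "reval (Pf 0) (x # xs) x"
  using reval.proj[of 0 "x # xs"] by simp

lemma reval_proj1: "reval (Pf (Suc 0)) (x # y # xs) y"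
  using reval.proj[of 1 "x # y # xs"] by simp

lemma reval_proj2: "reval (Pf 2) (x # y # z # xs) z"
  using reval.proj[of 2 "x # y # z # xs"] by simp

lemmas reval_proj = reval_proj0 reval_proj1 reval_proj2

primrec constF :: "nat \<Rightarrow> recf" where
  "constF 0 = Zf"
| "constF (Suc n) = Cf Sf [constF n]"

lemma reval_constF: "reval (constF n) xs n"
  by (induction n) (auto intro: reval.zero reval_comp1 reval.succ)

definition addF :: recf where
  "addF = Rf (Pf 0) (Cf Sf [Pf 1])"

lemma reval_addF: "reval addF [n, m] (n + m)"
  unfolding addF_def
  by (induction n)
    (auto intro: reval.prim0 reval.primS reval_proj reval_comp1 reval.succ)

definition triF :: recf where
  "triF = Rf Zf (Cf addF [Pf 1, Cf Sf [Pf 0]])"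

lemma reval_triF: "reval triF [n] (triangle n)"
  unfolding triF_def
proof (induction n)
  case 0
  show ?case by (auto intro: reval.prim0 reval.zero)
next
  case (Suc n)
  have "reval (Cf addF [Pf 1, Cf Sf [Pf 0]]) [n, triangle n] (triangle n + Suc n)"
    by (intro reval_comp2[OF _ _ reval_addF])
      (auto intro: reval_proj reval_comp1 reval.succ)
  with Suc show ?case by (auto intro: reval.primS)
qed

definition pairF :: recf where
  "pairF = Cf addF [Cf triF [addF], Pf 0]"

lemma reval_pairF: "reval pairF [m, n] (prod_encode (m, n))"
  unfolding pairF_def prod_encode_def prod.case
  by (intro reval_comp2[OF _ _ reval_addF] reval_comp1[OF _ reval_triF] reval_addF reval_proj)

text \<open>Primitive recursion runs on the first argument, so the subtrahend comes first.\<close>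

definition subF :: recf where
  "subF = Rf (Pf 0) (Cf (Rf Zf (Pf 0)) [Pf 1])"

lemma reval_subF: "reval subF [n, m] (m - n)"
proof -
  have pred: "reval (Rf Zf (Pf 0)) [k] (k - 1)" for k
  proof (induction k)
    case 0
    show ?case using reval.prim0[OF reval.zero[of "[]"], of "Pf 0"] by simp
  next
    case (Suc k)
    then show ?case using reval.primS[OF Suc reval_proj0] by simp
  qed
  show ?thesis
    unfolding subF_def
  proof (induction n)
    case 0
    show ?case by (auto intro: reval.prim0 reval_proj)
  next
    case (Suc n)
    have "reval (Cf (Rf Zf (Pf 0)) [Pf 1]) [n, m - n, m] (m - n - 1)"
      by (rule reval_comp1[OF _ pred]) (simp add: reval_proj)
    with Suc show ?case by (auto intro: reval.primS)
  qed
qed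

text \<open>First step in inverting the Cantor pairing: a code \<open>k\<close> lies on the diagonal
  \<open>a + b\<close>, which is the least \<open>s\<close> with
  \<open>k < triangle (Suc s)\<close>, that is, with
  \<open>Suc k - triangle (Suc s) = 0\<close>.\<close>

definition sumF :: recf where
  "sumF = Mf (Cf subF [Cf triF [Cf Sf [Pf 0]], Cf Sf [Pf 1]])"

lemma triangle_mono: "m \<le> n \<Longrightarrow> triangle m \<le> triangle n"
  by (induction n rule: dec_induct) auto

lemma reval_sumF: "reval sumF [prod_encode (a, b)] (a + b)"
proof -
  define k where "k = prod_encode (a, b)"
  have k: "k = triangle (a + b) + a" by (simp add: k_def prod_encode_def)
  let ?f = "Cf subF [Cf triF [Cf Sf [Pf 0]], Cf Sf [Pf 1]]"
  have f: "reval ?f [s, k] (Suc k - triangle (Suc s))" for s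
    by (intro reval_comp2[OF _ _ reval_subF] reval_comp1[OF _ reval_triF])
      (auto intro: reval_comp1 reval.succ reval_proj)
  have "reval ?f [a + b, k] 0"
    using f[of "a + b"] k by simp
  moreover have "\<exists>y. reval ?f [m, k] y \<and> y > 0" if "m < a + b" for m
  proof -
    have "triangle (Suc m) \<le> triangle (a + b)"
      using that by (intro triangle_mono) simp
    then have "Suc k - triangle (Suc m) > 0" by (simp add: k)
    then show ?thesis using f[of m] by blast
  qed
  ultimately show ?thesis
    unfolding sumF_def k_def by (intro reval.mini) auto
qed

definition fstF :: recf where
  "fstF = Cf subF [Cf triF [sumF], Pf 0]"

lemma reval_fstF: "reval fstF [prod_encode (a, b)] a"
proof -
  have "reval fstF [prod_encode (a, b)] (prod_encode (a, b) - triangle (a + b))"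
    unfolding fstF_def
    by (intro reval_comp2[OF _ _ reval_subF] reval_comp1[OF _ reval_triF] reval_sumF reval_proj)
  then show ?thesis by (simp add: prod_encode_def)
qed

definition sndF :: recf where
  "sndF = Cf subF [fstF, sumF]"

lemma reval_sndF: "reval sndF [prod_encode (a, b)] b"
proof -
  have "reval sndF [prod_encode (a, b)] ((a + b) - a)"
    unfolding sndF_def
    by (intro reval_comp2[OF _ _ reval_subF] reval_sumF reval_fstF)
  then show ?thesis by simp
qed

section \<open>Encoded types and closure properties of recursive functions between them\<close>

class enc =
  fixes enc :: "'a \<Rightarrow> nat"
  assumes enc_inject: "enc x = enc y \<Longrightarrow> x = y"
begin

lemma enc_eq_iff: "enc x = enc y \<longleftrightarrow> x = y"
  using enc_inject by blast

end

instantiation nat :: enc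
begin
definition enc_nat_def [simp]: "enc (n :: nat) = n"
instance by standard simp
end

instantiation bool :: enc
begin
definition enc_bool_def: "enc b = (if b then 1 else 0 :: nat)"
instance by standard (simp add: enc_bool_def split: if_splits)
end

instantiation prod :: (enc, enc) enc
begin
definition enc_prod_def: "enc p = prod_encode (enc (fst p), enc (snd p))"
instance by standard (auto simp: enc_prod_def enc_eq_iff prod_eq_iff)
end

instantiation list :: (enc) enc
begin
definition enc_list_def: "enc xs = list_encode (map enc xs)"
instance
proof
  fix xs ys :: "'a list"
  assume "enc xs = enc ys"
  then have "map enc xs = map enc ys"
    by (metis enc_list_def list_encode_inverse)
  moreover have "inj (enc :: 'a \<Rightarrow> nat)" by (simp add: inj_on_def enc_eq_iff)
  ultimately show "xs = ys" by (metis inj_map_eq_map)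
qed
end

text \<open>One unary notion covers all arities: the variables in scope form a tuple
  \<open>v\<close>, coded as a single number, so that the closure rules can follow the syntax of a
  definition.\<close>

definition rc :: "('a::enc \<Rightarrow> 'b::enc) \<Rightarrow> bool" where
  "rc f \<longleftrightarrow> (\<exists>F. \<forall>x. reval F [enc x] (enc (f x)))"

lemma rcI: "(\<And>x. reval F [enc x] (enc (f x))) \<Longrightarrow> rc f"
  by (auto simp: rc_def)

lemma rc_const: "rc (\<lambda>v. c)"
  by (rule rcI, rule reval_constF)

lemma rc_id: "rc (\<lambda>v. v)"
  by (rule rcI, rule reval_proj0)

lemma rc_comp:
  assumes "rc g" "rc f"
  shows "rc (\<lambda>v. g (f v))"
proof -
  obtain F G where "\<And>x. reval F [enc x] (enc (f x))" "\<And>x. reval G [enc x] (enc (g x))"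
    using assms by (auto simp: rc_def)
  then show ?thesis by (intro rcI[of "Cf G [F]"] reval_comp1)
qed

lemma rc_Pair:
  assumes "rc f" "rc g"
  shows "rc (\<lambda>v. (f v, g v))"
proof -
  obtain F G where "\<And>x. reval F [enc x] (enc (f x))" "\<And>x. reval G [enc x] (enc (g x))"
    using assms by (auto simp: rc_def)
  then show ?thesis
    unfolding enc_prod_def fst_conv snd_conv
    by (intro rcI[of "Cf pairF [F, G]"]) (auto simp: enc_prod_def intro: reval_comp2 reval_pairF)
qed

lemma rc_fst: "rc f \<Longrightarrow> rc (\<lambda>v. fst (f v))"
  by (rule rc_comp[of fst]) (simp_all add: rcI[of fstF] reval_fstF enc_prod_def)

lemma rc_snd: "rc f \<Longrightarrow> rc (\<lambda>v. snd (f v))"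
  by (rule rc_comp[of snd]) (simp_all add: rcI[of sndF] reval_sndF enc_prod_def)

lemma rc_comp2:
  assumes "rc (\<lambda>u. h (fst u) (snd u))" "rc f" "rc g"
  shows "rc (\<lambda>v. h (f v) (g v))"
  using rc_comp[OF assms(1) rc_Pair[OF assms(2,3)]] by simp

lemma rc_comp3:
  assumes "rc (\<lambda>u. h (fst u) (fst (snd u)) (snd (snd u)))" "rc f" "rc g" "rc k"
  shows "rc (\<lambda>v. h (f v) (g v) (k v))"
  using rc_comp[OF assms(1) rc_Pair[OF assms(2) rc_Pair[OF assms(3,4)]]] by simp

lemma rc_Suc: "rc f \<Longrightarrow> rc (\<lambda>v. Suc (f v))"
  by (rule rc_comp[of Suc]) (simp_all add: rcI[of Sf] reval.succ)

lemma rc_rec_nat: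
  fixes z :: "'a::enc \<Rightarrow> 'b::enc"
  assumes "rc n" "rc z" "rc (\<lambda>u. s (fst u) (fst (snd u)) (snd (snd u)))"
  shows "rc (\<lambda>v. rec_nat (z v) (\<lambda>i r. s i r v) (n v))"
proof -
  obtain N Z S where N: "\<And>x. reval N [enc x] (enc (n x))"
    and Z: "\<And>x. reval Z [enc x] (enc (z x))"
    and S: "\<And>u. reval S [enc u] (enc (s (fst u) (fst (snd u)) (snd (snd u))))"
    using assms unfolding rc_def by blast
  \<comment> \<open>\<open>Rf\<close> passes counter, previous value and parameter as three
    arguments, while \<open>S\<close> expects the code of a triple.\<close>
  let ?S = "Cf S [Cf pairF [Pf 0, Cf pairF [Pf 1, Pf 2]]]"
  have S': "reval ?S [i, enc r, enc v] (enc (s i r v))" for i r v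
  proof (rule reval_comp1)
    show "reval (Cf pairF [Pf 0, Cf pairF [Pf 1, Pf 2]]) [i, enc r, enc v] (enc (i, r, v))"
      unfolding enc_prod_def fst_conv snd_conv One_nat_def enc_nat_def
      by (intro reval_comp2[OF _ _ reval_pairF] reval_proj)
    show "reval S [enc (i, r, v)] (enc (s i r v))"
      using S[of "(i, r, v)"] by simp
  qed
  have R: "reval (Rf Z ?S) [k, enc v] (enc (rec_nat (z v) (\<lambda>i r. s i r v) k))" for k v
  proof (induction k)
    case 0
    show ?case using Z by (auto intro: reval.prim0)
  next
    case (Suc k)
    then show ?case using S' by (auto intro: reval.primS)
  qed
  show ?thesis
    by (rule rcI[of "Cf (Rf Z ?S) [N, Pf 0]"], rule reval_comp2[OF _ _ R])
      (use N in \<open>auto intro: reval_proj\<close>)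
qed

lemma rc_of_bool: "rc P \<Longrightarrow> rc (\<lambda>v. of_bool (P v) :: nat)"
  by (simp add: rc_def enc_bool_def of_bool_def)

lemma rc_if:
  assumes "rc P" "rc f" "rc g"
  shows "rc (\<lambda>v. if P v then f v else g v)"
proof -
  \<comment> \<open>A case distinction is a recursion of length 0 or 1.\<close>
  have "rc (\<lambda>v. rec_nat (g v) (\<lambda>i r. f v) (of_bool (P v)))"
    by (intro rc_rec_nat rc_of_bool assms rc_comp[OF assms(2)] rc_snd rc_id)
  moreover have "rec_nat (g v) (\<lambda>i r. f v) (of_bool (P v)) = (if P v then f v else g v)" for v
    by simp
  ultimately show ?thesis by simp
qed

lemma rc_not: "rc P \<Longrightarrow> rc (\<lambda>v. \<not> P v)"
  using rc_if[OF _ rc_const[of False] rc_const[of True], of P] by (simp add: if_bool_eq_conj)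

lemma rc_conj: "rc P \<Longrightarrow> rc Q \<Longrightarrow> rc (\<lambda>v. P v \<and> Q v)"
  using rc_if[OF _ _ rc_const[of False], of P Q] by (simp add: if_bool_eq_disj)

lemma rc_disj: "rc P \<Longrightarrow> rc Q \<Longrightarrow> rc (\<lambda>v. P v \<or> Q v)"
  using rc_not[OF rc_conj[OF rc_not rc_not], of P Q] by simp

lemma rc_imp: "rc P \<Longrightarrow> rc Q \<Longrightarrow> rc (\<lambda>v. P v \<longrightarrow> Q v)"
  using rc_disj[OF rc_not, of P Q] by simp

lemma rc_diff_nat: "rc f \<Longrightarrow> rc g \<Longrightarrow> rc (\<lambda>v. f v - g v :: nat)"
proof (rule rc_comp2[of "(-)"])
  show "rc (\<lambda>u. fst u - snd u :: nat)"
    unfolding rc_def enc_prod_def enc_nat_def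
    by (intro exI[of _ "Cf subF [sndF, fstF]"] allI reval_comp2[OF _ _ reval_subF] reval_fstF reval_sndF)
qed

lemma rc_enc: "rc f \<Longrightarrow> rc (\<lambda>v. enc (f v))"
  by (simp add: rc_def)

lemma rc_eq_0: "rc f \<Longrightarrow> rc (\<lambda>v. f v = (0::nat))"
proof (rule rc_comp[of "\<lambda>x. x = 0"])
  have "rc (\<lambda>x::nat. rec_nat True (\<lambda>i r. False) x)"
    by (intro rc_rec_nat rc_id rc_const)
  moreover have "rec_nat True (\<lambda>i r. False) x = (x = 0)" for x
    by (cases x) auto
  ultimately show "rc (\<lambda>x::nat. x = 0)" by simp
qed

lemma rc_le_nat: "rc f \<Longrightarrow> rc g \<Longrightarrow> rc (\<lambda>v. f v \<le> (g v :: nat))"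
  using rc_eq_0[OF rc_diff_nat, of f g] by simp

lemma rc_less_nat: "rc f \<Longrightarrow> rc g \<Longrightarrow> rc (\<lambda>v. f v < (g v :: nat))"
  using rc_le_nat[OF rc_Suc, of f g] by (simp add: Suc_le_eq)

text \<open>Equality is tested on the codes, which is faithful because \<open>enc\<close> is
  injective.\<close>

lemma rc_eq: "rc f \<Longrightarrow> rc g \<Longrightarrow> rc (\<lambda>v. f v = g v)"
  using rc_conj[OF rc_le_nat[OF rc_enc rc_enc] rc_le_nat[OF rc_enc rc_enc], of f g g f]
  unfolding eq_iff[symmetric] enc_eq_iff by simp

text \<open>Binders extend the environment: inside the body the bound variable is the first component.\<close>

lemma rc_all_less:
  fixes P :: "nat \<Rightarrow> 'a::enc \<Rightarrow> bool"
  assumes "rc n" "rc (\<lambda>u. P (fst u) (snd u))"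
  shows "rc (\<lambda>v. \<forall>i<n v. P i v)"
proof -
  have "rc (\<lambda>v. rec_nat True (\<lambda>i r. r \<and> P i v) (n v))"
    by (intro rc_rec_nat assms rc_const rc_conj rc_comp2[OF assms(2)] rc_fst rc_snd rc_id)
  moreover have "rec_nat True (\<lambda>i r. r \<and> P i v) k = (\<forall>i<k. P i v)" for k v
    by (induction k) (auto simp: less_Suc_eq)
  ultimately show ?thesis by simp
qed

lemma rc_ex_less:
  fixes P :: "nat \<Rightarrow> 'a::enc \<Rightarrow> bool"
  assumes "rc n" "rc (\<lambda>u. P (fst u) (snd u))"
  shows "rc (\<lambda>v. \<exists>i<n v. P i v)"
  using rc_not[OF rc_all_less[OF assms(1) rc_not[OF assms(2)]]] by simp

lemma rc_all_le:
  fixes P :: "nat \<Rightarrow> 'a::enc \<Rightarrow> bool"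
  assumes "rc n" "rc (\<lambda>u. P (fst u) (snd u))"
  shows "rc (\<lambda>v. \<forall>i\<le>n v. P i v)"
  using rc_all_less[OF rc_Suc[OF assms(1)] assms(2)] by (simp add: less_Suc_eq_le)

lemma rc_ex_le:
  fixes P :: "nat \<Rightarrow> 'a::enc \<Rightarrow> bool"
  assumes "rc n" "rc (\<lambda>u. P (fst u) (snd u))"
  shows "rc (\<lambda>v. \<exists>i\<le>n v. P i v)"
  using rc_ex_less[OF rc_Suc[OF assms(1)] assms(2)] by (simp add: less_Suc_eq_le)

text \<open>Bounded search with default: the value is the least \<open>i < n\<close> satisfying
  \<open>P\<close>, or \<open>n\<close> if there is none.\<close>

primrec bmin :: "nat \<Rightarrow> (nat \<Rightarrow> bool) \<Rightarrow> nat" where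
  "bmin 0 P = 0"
| "bmin (Suc n) P = (if P (bmin n P) then bmin n P else Suc (bmin n P))"

lemma bmin_cases: "(bmin n P = n \<or> bmin n P < n \<and> P (bmin n P)) \<and> (\<forall>i<bmin n P. \<not> P i)"
  by (induction n) (auto simp: less_Suc_eq)

lemma bmin_works: "bmin n P < n \<Longrightarrow> P (bmin n P)"
  using bmin_cases[of n P] by auto

lemma bmin_le: "P k \<Longrightarrow> bmin n P \<le> k"
  using bmin_cases[of n P] by (meson not_le_imp_less)

lemma rc_bmin:
  fixes P :: "nat \<Rightarrow> 'a::enc \<Rightarrow> bool"
  assumes "rc n" "rc (\<lambda>u. P (fst u) (snd u))"
  shows "rc (\<lambda>v. bmin (n v) (\<lambda>i. P i v))"
proof -
  have "rc (\<lambda>v. rec_nat 0 (\<lambda>i r. if P r v then r else Suc r) (n v))"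
    by (intro rc_rec_nat assms rc_const rc_if rc_Suc rc_comp2[OF assms(2)] rc_fst rc_snd rc_id)
  moreover have "rec_nat 0 (\<lambda>i r. if P r v then r else Suc r) k = bmin k (\<lambda>i. P i v)" for k v
    by (induction k) auto
  ultimately show ?thesis by simp
qed

declare bmin.simps [simp del]

section \<open>Arithmetic and lists\<close>

lemma rc_add: "rc f \<Longrightarrow> rc g \<Longrightarrow> rc (\<lambda>v. f v + g v :: nat)"
proof (rule rc_comp2[of "(+)"])
  show "rc (\<lambda>u. fst u + snd u :: nat)"
    unfolding rc_def enc_prod_def enc_nat_def
    by (intro exI[of _ "Cf addF [fstF, sndF]"] allI reval_comp2[OF _ _ reval_addF] reval_fstF reval_sndF)
qed

lemma rc_mult:
  assumes "rc f" "rc g"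
  shows "rc (\<lambda>v. f v * g v :: nat)"
proof -
  have "rc (\<lambda>v. rec_nat 0 (\<lambda>i r. r + g v) (f v))"
    by (intro rc_rec_nat assms rc_const rc_add rc_comp[OF assms(2)] rc_fst rc_snd rc_id)
  moreover have "rec_nat 0 (\<lambda>i r. r + b) a = a * b" for a b :: nat
    by (induction a) auto
  ultimately show ?thesis by simp
qed

lemma rc_power2:
  assumes "rc f"
  shows "rc (\<lambda>v. 2 ^ f v :: nat)"
proof -
  have "rc (\<lambda>v. rec_nat 1 (\<lambda>i r. 2 * r) (f v) :: nat)"
    by (intro rc_rec_nat assms rc_const rc_mult rc_fst rc_snd rc_id)
  moreover have "rec_nat 1 (\<lambda>i r. 2 * r) a = (2 ^ a :: nat)" for a :: nat
    by (induction a) auto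
  ultimately show ?thesis by simp
qed

lemma rc_div:
  assumes "rc f" "rc g"
  shows "rc (\<lambda>v. f v div g v :: nat)"
proof (rule rc_comp2[of "(div)", OF _ assms])
  \<comment> \<open>The quotient is the least \<open>q\<close> with \<open>a < b * Suc q\<close>. It
    is at most \<open>a\<close>, so when the search below \<open>a\<close> fails the default
    \<open>a\<close> is correct.\<close>
  have eq: "a div b = (if b = 0 then 0 else bmin a (\<lambda>q. a < b * Suc q))" for a b :: nat
  proof (cases "b = 0")
    case False
    let ?q = "a div b"
    have "a < b * Suc ?q" using False by (simp add: dividend_less_times_div)
    then have le: "bmin a (\<lambda>q. a < b * Suc q) \<le> ?q" by (rule bmin_le)
    have "?q \<le> bmin a (\<lambda>q. a < b * Suc q)"
    proof (cases "bmin a (\<lambda>q. a < b * Suc q) < a")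
      case True
      from bmin_works[OF this] have "a < b * Suc (bmin a (\<lambda>q. a < b * Suc q))" .
      then have "?q < Suc (bmin a (\<lambda>q. a < b * Suc q))"
        using False by (simp add: div_less_iff_less_mult mult.commute)
      then show ?thesis by simp
    next
      case nb: False
      then show ?thesis using div_le_dividend[of a b] by linarith
    qed
    with le False show ?thesis by simp
  qed simp
  show "rc (\<lambda>u. fst u div snd u :: nat)"
    unfolding eq
    by (intro rc_if rc_eq_0 rc_const rc_bmin rc_less_nat rc_mult rc_Suc rc_fst rc_snd rc_id)
qed

lemma rc_mod:
  assumes "rc f" "rc g"
  shows "rc (\<lambda>v. f v mod g v :: nat)"
  unfolding modulo_nat_def
  using assms by (intro rc_diff_nat rc_mult rc_div)

lemma rc_odd: "rc f \<Longrightarrow> rc (\<lambda>v. odd (f v :: nat))"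
  unfolding odd_iff_mod_2_eq_one by (intro rc_eq rc_mod rc_const)

lemma rc_Cons:
  assumes "rc f" "rc g"
  shows "rc (\<lambda>v. f v # g v)"
proof -
  have "rc (\<lambda>v. Suc (enc (f v, g v)))"
    by (intro rc_Suc rc_enc rc_Pair assms)
  then show ?thesis by (simp add: rc_def enc_list_def enc_prod_def)
qed

lemma rc_is_Nil: "rc f \<Longrightarrow> rc (\<lambda>v. f v = [])"
  by (intro rc_eq rc_const)

lemma rc_hd: "rc f \<Longrightarrow> rc (\<lambda>v. hd (f v))"
proof (rule rc_comp[of hd])
  have "rc (\<lambda>n::nat. n - 1)" by (intro rc_diff_nat rc_id rc_const)
  then obtain G where G: "\<And>n. reval G [n] (n - 1)"
    by (auto simp: rc_def)
  \<comment> \<open>The code 0 is the empty list, whose \<open>hd\<close> is an unspecified but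
    fixed value; it is built in as a constant.\<close>
  have "rc (\<lambda>n::nat. if n = 0 then enc (hd [] :: 'b) else fst (prod_decode (n - 1)))"
  proof (intro rc_if rc_eq rc_id rc_const)
    have "\<And>n. reval (Cf fstF [G]) [n] (fst (prod_decode (n - 1)))"
      by (rule reval_comp1[OF G]) (metis reval_fstF prod.collapse prod_decode_inverse)
    then show "rc (\<lambda>n::nat. fst (prod_decode (n - 1)))"
      by (intro rcI[of "Cf fstF [G]"]) simp
  qed
  then obtain H where H: "\<And>n. reval H [n] (if n = 0 then enc (hd [] :: 'b) else fst (prod_decode (n - 1)))"
    by (auto simp: rc_def)
  show "rc (hd :: 'b list \<Rightarrow> 'b)"
  proof (rule rcI[of H])
    fix xs :: "'b list"
    show "reval H [enc xs] (enc (hd xs))"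
      using H[of "enc xs"] by (cases xs) (auto simp: enc_list_def)
  qed
qed

lemma rc_tl: "rc f \<Longrightarrow> rc (\<lambda>v. tl (f v))"
proof (rule rc_comp[of tl])
  have "rc (\<lambda>n::nat. n - 1)" by (intro rc_diff_nat rc_id rc_const)
  then obtain G where G: "\<And>n. reval G [n] (n - 1)"
    by (auto simp: rc_def)
  have "rc (\<lambda>n::nat. if n = 0 then 0 else snd (prod_decode (n - 1)))"
  proof (intro rc_if rc_eq rc_id rc_const)
    have "\<And>n. reval (Cf sndF [G]) [n] (snd (prod_decode (n - 1)))"
      by (rule reval_comp1[OF G]) (metis reval_sndF prod.collapse prod_decode_inverse)
    then show "rc (\<lambda>n::nat. snd (prod_decode (n - 1)))"
      by (intro rcI[of "Cf sndF [G]"]) simp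
  qed
  then obtain H where H: "\<And>n. reval H [n] (if n = 0 then 0 else snd (prod_decode (n - 1)))"
    by (auto simp: rc_def)
  show "rc (tl :: 'b list \<Rightarrow> 'b list)"
  proof (rule rcI[of H])
    fix xs :: "'b list"
    show "reval H [enc xs] (enc (tl xs))"
      using H[of "enc xs"] by (cases xs) (auto simp: enc_list_def)
  qed
qed

lemma rc_drop:
  assumes "rc n" "rc f"
  shows "rc (\<lambda>v. drop (n v) (f v))"
proof -
  have "rc (\<lambda>v. rec_nat (f v) (\<lambda>i r. tl r) (n v))"
    by (intro rc_rec_nat assms rc_tl rc_fst rc_snd rc_id)
  moreover have "rec_nat xs (\<lambda>i r. tl r) k = drop k xs" for k and xs :: "'b list"
    by (induction k) (auto simp: drop_Suc tl_drop)
  ultimately show ?thesis by simp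
qed

lemma length_le_enc: "length xs \<le> enc xs"
  unfolding enc_list_def
  by (induction xs) (auto intro: le_trans[OF _ le_prod_encode_2])

lemma rc_length:
  assumes "rc f"
  shows "rc (\<lambda>v. length (f v))"
proof -
  \<comment> \<open>The code of a list bounds its length, so the search for the first empty tail is
    a bounded one.\<close>
  have eq: "length xs = bmin (enc xs) (\<lambda>i. drop i xs = [])" for xs :: "'b list"
  proof (rule antisym)
    show "length xs \<le> bmin (enc xs) (\<lambda>i. drop i xs = [])"
      using bmin_works[of "enc xs" "\<lambda>i. drop i xs = []"] length_le_enc[of xs]
      by (metis bmin_cases drop_eq_Nil)
    show "bmin (enc xs) (\<lambda>i. drop i xs = []) \<le> length xs"
      by (rule bmin_le) simp
  qed
  show ?thesis
    unfolding eq
    by (intro rc_bmin rc_enc assms rc_is_Nil rc_drop rc_comp[OF assms] rc_fst rc_snd rc_id)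
qed

lemma rc_Ex_set:
  assumes "rc f" "rc (\<lambda>u. P (fst u) (snd u))"
  shows "rc (\<lambda>v. \<exists>x\<in>set (f v). P x v)"
proof -
  have eq: "(\<exists>x\<in>set xs. Q x) = (\<exists>i<length xs. Q (hd (drop i xs)))" for xs :: "'b list" and Q
    by (metis hd_drop_conv_nth in_set_conv_nth)
  show ?thesis
    unfolding eq
    by (intro rc_ex_less rc_length assms rc_comp2[OF assms(2)] rc_hd rc_drop rc_comp[OF assms(1)]
        rc_fst rc_snd rc_id)
qed

lemma rc_mem:
  assumes "rc f" "rc g"
  shows "rc (\<lambda>v. f v \<in> set (g v))"
proof -
  have "rc (\<lambda>v. \<exists>x\<in>set (g v). x = f v)"
    by (intro rc_Ex_set assms rc_eq rc_comp[OF assms(1)] rc_fst rc_snd rc_id)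
  then show ?thesis by simp
qed

lemmas rc_intros = rc_Pair rc_fst rc_snd rc_Suc rc_if rc_not rc_conj rc_disj rc_imp rc_diff_nat
  rc_le_nat rc_less_nat rc_eq rc_all_less rc_ex_less rc_all_le rc_ex_le rc_bmin rc_add rc_mult
  rc_power2 rc_div rc_mod rc_odd rc_Cons rc_hd rc_tl rc_drop rc_length rc_Ex_set rc_mem rc_id rc_const

subsection \<open>Certificates for evaluations\<close>

text \<open>Ensures that a program returning 1 on some input cannot also return 0 there, so the
  value 0 expresses failure of the coded relation.\<close>

lemma reval_deterministic: "reval F xs y \<Longrightarrow> reval F xs z \<Longrightarrow> y = z"
proof (induction arbitrary: z rule: reval.induct)
  case (comp xs gs ys f w)
  from comp.prems obtain ys' where ys': "list_all2 (\<lambda>g y. reval g xs y) gs ys'" "reval f ys' z"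
    by (cases rule: reval.cases) auto
  have "ys = ys'"
    using comp.IH(1) ys'(1) by (simp add: list_all2_conv_all_nth list_eq_iff_nth_eq)
  then show ?case using comp.IH(2) ys'(2) by simp
next
  case (mini f n xs)
  from mini.prems obtain 0: "reval f (z # xs) 0"
    and pos: "\<forall>m<z. \<exists>y. reval f (m # xs) y \<and> y > 0"
    by (cases rule: reval.cases) auto
  have "\<not> n < z" using pos mini.IH(1) by blast
  moreover have "\<not> z < n" using mini.IH(2) 0 by (metis less_irrefl)
  ultimately show ?case by simp
next
  case (zero xs)
  then show ?case by (cases rule: reval.cases) auto
next
  case (succ x xs)
  then show ?case by (cases rule: reval.cases) auto
next
  case (proj i xs)
  from proj.prems show ?case by (cases rule: reval.cases) auto
next
  case (prim0 f xs y g)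
  from prim0.prems have "reval f xs z" by (cases rule: reval.cases) auto
  then show ?case by (rule prim0.IH)
next
  case (primS f g n xs y w)
  from primS.prems obtain y' where "reval (Rf f g) (n # xs) y'" "reval g (n # y' # xs) z"
    by (cases rule: reval.cases) auto
  then show ?case using primS.IH by blast
qed

fun code :: "recf \<Rightarrow> nat" where
  "code Zf = prod_encode (0, 0)"
| "code Sf = prod_encode (1, 0)"
| "code (Pf i) = prod_encode (2, i)"
| "code (Cf f gs) = prod_encode (3, prod_encode (code f, list_encode (map code gs)))"
| "code (Rf f g) = prod_encode (4, prod_encode (code f, code g))"
| "code (Mf f) = prod_encode (5, code f)"

type_synonym entry = "nat \<times> nat list \<times> nat"

text \<open>An entry \<open>(c, xs, z)\<close> claims that the program with code \<open>c\<close> returns \<open>z\<close> on \<open>xs\<close>; it is justified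
  by entries occurring later in the list.\<close>

definition justified :: "entry list \<Rightarrow> entry \<Rightarrow> bool" where
  "justified S p \<longleftrightarrow>
    (let c = fst p; xs = fst (snd p); z = snd (snd p);
         tag = fst (prod_decode c); d = snd (prod_decode c);
         f = fst (prod_decode d); g = snd (prod_decode d) in
      tag = 0 \<and> z = 0
    \<or> tag = 1 \<and> xs \<noteq> [] \<and> z = Suc (hd xs)
    \<or> tag = 2 \<and> d < length xs \<and> z = hd (drop d xs)
    \<or> tag = 3 \<and> (\<exists>q\<in>set S. fst q = f \<and> snd (snd q) = z \<and>
        length (fst (snd q)) = length (list_decode g) \<and>
        (\<forall>i<length (list_decode g).
          (hd (drop i (list_decode g)), xs, hd (drop i (fst (snd q)))) \<in> set S))
    \<or> tag = 4 \<and> xs \<noteq> [] \<and> hd xs = 0 \<and> (f, tl xs, z) \<in> set S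
    \<or> tag = 4 \<and> xs \<noteq> [] \<and> hd xs \<noteq> 0 \<and> (\<exists>q\<in>set S. fst q = c \<and>
        fst (snd q) = (hd xs - 1) # tl xs \<and> (g, (hd xs - 1) # snd (snd q) # tl xs, z) \<in> set S)
    \<or> tag = 5 \<and> (d, z # xs, 0) \<in> set S \<and>
        (\<forall>m<z. \<exists>q\<in>set S. fst q = d \<and> fst (snd q) = m # xs \<and> 0 < snd (snd q)))"

primrec valid :: "entry list \<Rightarrow> bool" where
  "valid [] \<longleftrightarrow> True"
| "valid (p # S) \<longleftrightarrow> justified S p \<and> valid S"

text \<open>A bounded quantifier in place of the recursion on lists, so that the rules for
  \<open>rc\<close> apply.\<close>

lemma valid_conv_all_drop:
  "valid S \<longleftrightarrow> (\<forall>i<length S. justified (drop (Suc i) S) (hd (drop i S)))"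
  by (induction S) (auto simp: All_less_Suc2)

text \<open>\<open>justified\<close> is written with projections, \<open>hd\<close>,
  \<open>drop\<close> and bounded quantifiers for the sake of recursiveness; here its clauses take
  the shape of the rules of \<open>reval\<close>.\<close>

lemma justified_simps:
  "justified S (prod_encode (0, d), xs, z) \<longleftrightarrow> z = 0"
  "justified S (prod_encode (1, d), xs, z) \<longleftrightarrow> xs \<noteq> [] \<and> z = Suc (hd xs)"
  "justified S (prod_encode (2, d), xs, z) \<longleftrightarrow> d < length xs \<and> z = hd (drop d xs)"
  "justified S (prod_encode (3, prod_encode (f, list_encode gs)), xs, z) \<longleftrightarrow>
    (\<exists>ys. (f, ys, z) \<in> set S \<and> length ys = length gs \<and>
      (\<forall>i<length gs. (gs ! i, xs, ys ! i) \<in> set S))"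
  "justified S (prod_encode (4, prod_encode (f, g)), 0 # xs, z) \<longleftrightarrow> (f, xs, z) \<in> set S"
  "justified S (prod_encode (4, prod_encode (f, g)), Suc n # xs, z) \<longleftrightarrow>
    (\<exists>y. (prod_encode (4, prod_encode (f, g)), n # xs, y) \<in> set S \<and> (g, n # y # xs, z) \<in> set S)"
  "\<not> justified S (prod_encode (4, prod_encode (f, g)), [], z)"
  "justified S (prod_encode (5, d), xs, z) \<longleftrightarrow>
    (d, z # xs, 0) \<in> set S \<and> (\<forall>m<z. \<exists>y>0. (d, m # xs, y) \<in> set S)"
  by (auto simp: justified_def Let_def Bex_def hd_drop_conv_nth)

text \<open>\<open>S\<close> occurs only positively in \<open>justified\<close>. This is what allows
  certificates to be concatenated.\<close>

lemma justified_mono: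
  assumes "set S \<subseteq> set S'" "justified S p"
  shows "justified S' p"
proof -
  have sub: "q \<in> set S \<Longrightarrow> q \<in> set S'" for q using assms(1) by blast
  show ?thesis
    using assms(2) unfolding justified_def Let_def
    by (elim disjE conjE bexE) (simp_all add: sub, (meson sub)+)
qed

lemma valid_append: "valid S \<Longrightarrow> valid S' \<Longrightarrow> valid (S @ S')"
  by (induction S) (auto intro: justified_mono[rotated])

lemma justified_sound:
  assumes S: "\<And>G ys w. (code G, ys, w) \<in> set S \<Longrightarrow> reval G ys w"
    and j: "justified S (code F, xs, z)"
  shows "reval F xs z"
proof (cases F)
  case Zf
  then show ?thesis using j by (simp add: justified_simps reval.zero)
next
  case Sf
  then show ?thesis using j
    by (cases xs) (simp_all add: justified_simps(2)[simplified] reval.succ)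
next
  case (Pf i)
  then show ?thesis using j by (auto simp: justified_simps hd_drop_conv_nth intro: reval.proj)
next
  case (Cf f gs)
  then obtain ys where ys: "(code f, ys, z) \<in> set S" "length ys = length gs"
    and gs: "\<forall>i<length gs. (code (gs ! i), xs, ys ! i) \<in> set S"
    using j by (auto simp: justified_simps)
  have "list_all2 (\<lambda>g y. reval g xs y) gs ys"
    using ys(2) gs S by (simp add: list_all2_conv_all_nth)
  then show ?thesis using S[OF ys(1)] Cf by (auto intro: reval.comp)
next
  case (Rf f g)
  show ?thesis
  proof (cases xs)
    case Nil
    then show ?thesis using j Rf by (simp add: justified_simps)
  next
    case (Cons n xs')
    show ?thesis
    proof (cases n)
      case 0
      then show ?thesis using j Rf Cons S by (simp add: justified_simps reval.prim0)
    next
      case (Suc m)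
      then obtain y where "(code F, m # xs', y) \<in> set S" "(code g, m # y # xs', z) \<in> set S"
        using j Rf Cons by (auto simp: justified_simps)
      then show ?thesis using S Rf Cons Suc by (metis reval.primS)
    qed
  qed
next
  case (Mf f)
  then have "(code f, z # xs, 0) \<in> set S" "\<forall>m<z. \<exists>y>0. (code f, m # xs, y) \<in> set S"
    using j by (simp_all add: justified_simps)
  then show ?thesis using S Mf by (metis reval.mini)
qed

lemma valid_sound: "valid S \<Longrightarrow> (code F, xs, z) \<in> set S \<Longrightarrow> reval F xs z"
  by (induction S arbitrary: F xs z) (auto intro: justified_sound)

lemma valid_collect:
  assumes "\<And>i. i < (n::nat) \<Longrightarrow> \<exists>S. valid S \<and> p i \<in> set S"
  shows "\<exists>S. valid S \<and> (\<forall>i<n. p i \<in> set S)"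
  using assms
proof (induction n)
  case 0
  show ?case by (rule exI[of _ "[]"]) simp
next
  case (Suc n)
  then obtain S where S: "valid S" "\<forall>i<n. p i \<in> set S" by (meson less_SucI)
  obtain S' where S': "valid S'" "p n \<in> set S'" using Suc.prems by blast
  have "valid (S @ S')" using S S' by (simp add: valid_append)
  then show ?case using S S' by (intro exI[of _ "S @ S'"]) (auto simp: less_Suc_eq)
qed

lemma valid_extend: "valid S \<Longrightarrow> justified S p \<Longrightarrow> \<exists>S. valid S \<and> p \<in> set S"
  by (rule exI[of _ "p # S"]) simp

text \<open>Certificates for the premises of an evaluation rule are concatenated, and its conclusion
  is put in front.\<close>

lemma valid_complete: "reval F xs z \<Longrightarrow> \<exists>S. valid S \<and> (code F, xs, z) \<in> set S"
proof (induction rule: reval.induct)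
  case (zero xs)
  show ?case by (rule valid_extend[of "[]"]) (simp_all add: justified_simps justified_simps(2)[simplified])
next
  case (succ x xs)
  show ?case by (rule valid_extend[of "[]"]) (simp_all add: justified_simps justified_simps(2)[simplified])
next
  case (proj i xs)
  then show ?case by (intro valid_extend[of "[]"]) (auto simp: justified_simps hd_drop_conv_nth)
next
  case (comp xs gs ys f z)
  have len: "length ys = length gs" using comp.IH(1) by (simp add: list_all2_lengthD)
  have "\<exists>S. valid S \<and> (\<forall>i<length gs. (code (gs ! i), xs, ys ! i) \<in> set S)"
    using comp.IH(1) by (intro valid_collect) (simp add: list_all2_conv_all_nth)
  then obtain S where S: "valid S" "\<forall>i<length gs. (code (gs ! i), xs, ys ! i) \<in> set S" by blast
  obtain S' where S': "valid S'" "(code f, ys, z) \<in> set S'" using comp.IH(2) by blast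
  show ?case
  proof (rule valid_extend[of "S @ S'"])
    show "valid (S @ S')" using S S' by (simp add: valid_append)
    show "justified (S @ S') (code (Cf f gs), xs, z)"
      unfolding code.simps justified_simps using len S S' by (intro exI[of _ ys]) simp
  qed
next
  case (prim0 f xs y g)
  then obtain S where "valid S" "(code f, xs, y) \<in> set S" by blast
  then show ?case by (intro valid_extend[of S]) (simp_all add: justified_simps)
next
  case (primS f g n xs y z)
  then obtain S S' where S: "valid S" "(code (Rf f g), n # xs, y) \<in> set S"
    and S': "valid S'" "(code g, n # y # xs, z) \<in> set S'" by blast
  show ?case
  proof (rule valid_extend[of "S @ S'"])
    show "valid (S @ S')" using S S' by (simp add: valid_append)
    show "justified (S @ S') (code (Rf f g), Suc n # xs, z)"
      unfolding code.simps justified_simps using S S' by (intro exI[of _ y]) simp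
  qed
next
  case (mini f n xs)
  then obtain S where S: "valid S" "(code f, n # xs, 0) \<in> set S" by blast
  obtain y where y: "\<And>m. m < n \<Longrightarrow> y m > 0 \<and> (\<exists>S. valid S \<and> (code f, m # xs, y m) \<in> set S)"
    using mini.IH(2) by metis
  have "\<exists>S. valid S \<and> (\<forall>m<n. (code f, m # xs, y m) \<in> set S)"
    using y by (intro valid_collect) simp
  then obtain S' where S': "valid S'" "\<forall>m<n. (code f, m # xs, y m) \<in> set S'" by blast
  show ?case
  proof (rule valid_extend[of "S @ S'"])
    show "valid (S @ S')" using S S' by (simp add: valid_append)
    show "justified (S @ S') (code (Mf f), xs, n)"
      unfolding code.simps justified_simps using S S' y by auto
  qed
qed

section \<open>Recursive search through all certificates\<close>

lemma surj_enc_nat: "surj (enc :: nat \<Rightarrow> nat)"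
  by (auto simp: surj_def)

lemma surj_enc_prod:
  assumes "surj (enc :: 'a::enc \<Rightarrow> nat)" "surj (enc :: 'b::enc \<Rightarrow> nat)"
  shows "surj (enc :: 'a \<times> 'b \<Rightarrow> nat)"
proof (rule surjI)
  fix n
  obtain a b where "prod_decode n = (a, b)" by (cases "prod_decode n")
  then show "enc (inv (enc :: 'a \<Rightarrow> nat) (fst (prod_decode n)), inv (enc :: 'b \<Rightarrow> nat) (snd (prod_decode n))) = n"
    by (simp add: enc_prod_def surj_f_inv_f[OF assms(1)] surj_f_inv_f[OF assms(2)])
      (metis prod_decode_inverse)
qed

lemma surj_enc_list:
  assumes "surj (enc :: 'a::enc \<Rightarrow> nat)"
  shows "surj (enc :: 'a list \<Rightarrow> nat)"
  by (rule surjI[of _ "\<lambda>n. map (inv enc) (list_decode n)"])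
    (simp add: enc_list_def o_def surj_f_inv_f[OF assms])

text \<open>As \<open>enc\<close> is onto, the number \<open>f v\<close> is itself the code of
  \<open>inv enc (f v)\<close>, so the program for \<open>f\<close> already computes it.\<close>

lemma rc_inv_enc:
  assumes "surj (enc :: 'b::enc \<Rightarrow> nat)" "rc f"
  shows "rc (\<lambda>v. inv enc (f v) :: 'b)"
  using assms(2) by (simp add: rc_def surj_f_inv_f[OF assms(1)])

lemma surj_enc_entries: "surj (enc :: entry list \<Rightarrow> nat)"
  by (intro surj_enc_list surj_enc_prod surj_enc_nat)

lemma rc_prod_decode: "rc f \<Longrightarrow> rc (\<lambda>v. prod_decode (f v))"
  by (simp add: rc_def enc_prod_def)

lemma rc_list_decode: "rc f \<Longrightarrow> rc (\<lambda>v. list_decode (f v))"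
  by (simp add: rc_def enc_list_def enc_nat_def[abs_def])

lemma rc_justified: "rc f \<Longrightarrow> rc g \<Longrightarrow> rc (\<lambda>v. justified (f v) (g v))"
  by (rule rc_comp2[of justified])
    (unfold justified_def Let_def, intro rc_intros rc_prod_decode rc_list_decode)

lemma rc_valid: "rc f \<Longrightarrow> rc (\<lambda>v. valid (f v))"
  by (rule rc_comp[of valid])
    (unfold valid_conv_all_drop, intro rc_intros rc_justified)

text \<open>Stage \<open>t\<close> of the search for some \<open>d\<close> at which program
  \<open>e\<close> returns 0. The one bound \<open>t\<close> limits both the certificate and
  \<open>d\<close>, which makes the predicate recursive and monotone in \<open>t\<close>.\<close>

definition refuted :: "nat \<Rightarrow> nat \<Rightarrow> nat \<Rightarrow> nat \<Rightarrow> nat \<Rightarrow> bool" where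
  "refuted e x a b t \<longleftrightarrow>
    (\<exists>s\<le>t. valid (inv enc s) \<and> (\<exists>d\<le>t. (e, [x, a, b, d], 0) \<in> set (inv enc s :: entry list)))"

lemma refuted_mono: "refuted e x a b t \<Longrightarrow> t \<le> t' \<Longrightarrow> refuted e x a b t'"
  unfolding refuted_def by (meson le_trans)

lemma ex_refuted_iff: "(\<exists>t. refuted (code F) x a b t) \<longleftrightarrow> (\<exists>d. reval F [x, a, b, d] 0)"
proof
  assume "\<exists>d. reval F [x, a, b, d] 0"
  then obtain d S where S: "valid S" "(code F, [x, a, b, d], 0) \<in> set S"
    using valid_complete by blast
  have "inv enc (enc S) = S" by (simp add: inj_on_def enc_eq_iff)
  then have "refuted (code F) x a b (max (enc S) d)"
    unfolding refuted_def using S by (intro exI[of _ "enc S"] conjI exI[of _ d]) auto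
  then show "\<exists>t. refuted (code F) x a b t" by blast
qed (auto simp: refuted_def dest: valid_sound)

subsection \<open>Lowest and highest binary digit\<close>

text \<open>Bounded searches agreeing with \<open>mu\<close> and \<open>lam\<close> on positive numbers; at \<open>0\<close> the latter are unspecified.\<close>

definition high :: "nat \<Rightarrow> nat" where
  "high x = bmin x (\<lambda>n. x < 2 ^ Suc n)"

definition low :: "nat \<Rightarrow> nat" where
  "low x = bmin x (\<lambda>n. odd (x div 2 ^ n))"

lemma high_unique:
  assumes "2 ^ n \<le> x" "x < 2 ^ Suc n"
  shows "high x = n"
proof -
  have "high x \<le> n" unfolding high_def by (rule bmin_le) fact
  \<comment> \<open>Hence the search stops below its bound \<open>x\<close>, at a genuine witness
    and not at the default.\<close>
  moreover have "n < x" using assms(1) less_exp[of n] by linarith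
  ultimately have "x < 2 ^ Suc (high x)"
    using bmin_works[of x "\<lambda>n. x < 2 ^ Suc n"] by (simp add: high_def)
  then have "(2::nat) ^ n < 2 ^ Suc (high x)" using assms(1) by linarith
  then have "n < Suc (high x)" by (rule power_less_imp_less_exp[rotated]) simp
  with \<open>high x \<le> n\<close> show ?thesis by simp
qed

lemma high_bounds:
  assumes "0 < x"
  shows "2 ^ high x \<le> x" "x < 2 ^ Suc (high x)"
proof -
  obtain n where "2 ^ n \<le> x" "x < 2 ^ Suc n"
    using ex_power_ivl1[of 2 x] assms by auto
  then show "2 ^ high x \<le> x" "x < 2 ^ Suc (high x)" using high_unique by auto
qed

lemma low_unique:
  assumes "2 ^ n dvd x" "\<not> 2 ^ Suc n dvd x"
  shows "low x = n"
proof -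
  from assms(1) obtain k where k: "x = 2 ^ n * k" ..
  then have "odd k" using assms(2) by (auto elim!: evenE)
  then have "odd (x div 2 ^ n)" by (simp add: k)
  then have le: "low x \<le> n" unfolding low_def by (rule bmin_le)
  have "0 < k" using \<open>odd k\<close> by (cases k) auto
  then have "2 ^ n \<le> x" by (simp add: k)
  then have "n < x" using less_exp[of n] by linarith
  with le have "odd (x div 2 ^ low x)"
    using bmin_works[of x "\<lambda>n. odd (x div 2 ^ n)"] by (simp add: low_def)
  moreover have "even (x div 2 ^ low x)" if "low x < n"
  proof -
    have "x div 2 ^ low x = 2 ^ (n - low x) * k"
      using le by (simp add: k power_diff mult.commute div_mult_swap le_imp_power_dvd)
    then show ?thesis using that by simp
  qed
  ultimately show ?thesis using le by force
qed

lemma low_dvd: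
  assumes "0 < x"
  shows "2 ^ low x dvd x" "\<not> 2 ^ Suc (low x) dvd x"
proof -
  define n where "n = (LEAST n. \<not> 2 ^ Suc n dvd x)"
  have "\<not> 2 ^ Suc x dvd x"
  proof
    assume "2 ^ Suc x dvd x"
    then have "2 ^ Suc x \<le> x" using assms by (rule dvd_imp_le)
    then show False using less_exp[of "Suc x"] by linarith
  qed
  then have n: "\<not> 2 ^ Suc n dvd x" unfolding n_def by (rule LeastI)
  have "2 ^ n dvd x"
  proof (cases n)
    case (Suc k)
    then show ?thesis using not_less_Least[of k "\<lambda>n. \<not> 2 ^ Suc n dvd x"] by (simp add: n_def)
  qed simp
  with n show "2 ^ low x dvd x" "\<not> 2 ^ Suc (low x) dvd x" using low_unique by auto
qed

lemma low_le_high: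
  assumes "0 < x"
  shows "low x \<le> high x"
proof -
  have "2 ^ low x \<le> x" using low_dvd(1)[OF assms] assms by (rule dvd_imp_le)
  then have "(2::nat) ^ low x < 2 ^ Suc (high x)" using high_bounds(2)[OF assms] by linarith
  then have "low x < Suc (high x)" by (rule power_less_imp_less_exp[rotated]) simp
  then show ?thesis by simp
qed

lemma mu_eq_high:
  assumes "0 < x"
  shows "mu x = high x"
  unfolding mu_def
proof (rule Max_eqI)
  have less: "n \<le> high x" if "bit x n" for n
  proof (rule ccontr)
    assume "\<not> n \<le> high x"
    then have "(2::nat) ^ Suc (high x) \<le> 2 ^ n" by (intro power_increasing) auto
    then have "x div 2 ^ n = 0" using high_bounds(2)[OF assms] by simp
    then show False using that by (simp add: bit_iff_odd)
  qed
  then show "n \<le> high x" if "n \<in> {n. bit x n}" for n using that by simp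
  show "finite {n. bit x n}" using less by (auto intro: finite_subset[of _ "{..high x}"])
  have "x div 2 ^ high x = 1"
    using high_bounds[OF assms] by (intro div_nat_eqI) auto
  then show "high x \<in> {n. bit x n}" by (simp add: bit_iff_odd)
qed

lemma lam_eq_low:
  assumes "0 < x"
  shows "lam x = low x"
  unfolding lam_def
proof (rule Min_eqI)
  obtain k where k: "x = 2 ^ low x * k" using low_dvd(1)[OF assms] ..
  have "odd k"
  proof
    assume "even k"
    then have "2 ^ low x * 2 dvd (2::nat) ^ low x * k" by (intro mult_dvd_mono) auto
    then show False using low_dvd(2)[OF assms] k by (metis power_Suc2)
  qed
  have "x div 2 ^ low x = k" by (subst k) simp
  with \<open>odd k\<close> show "low x \<in> {n. bit x n}" by (simp add: bit_iff_odd)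
  show "low x \<le> n" if "n \<in> {n. bit x n}" for n
  proof (rule ccontr)
    assume n: "\<not> low x \<le> n"
    then have "2 ^ Suc n dvd x"
      using low_dvd(1)[OF assms] by (meson dvd_trans le_imp_power_dvd not_less_eq_eq)
    then obtain j where "x = 2 ^ n * (2 * j)" by auto
    then have "x div 2 ^ n = 2 * j" by simp
    then show False using that by (simp add: bit_iff_odd)
  qed
  have "n < x" if "bit x n" for n
  proof (rule ccontr)
    assume "\<not> n < x"
    then have "x < 2 ^ n" using less_exp[of n] by linarith
    then show False using that by (simp add: bit_iff_odd)
  qed
  then show "finite {n. bit x n}" by (auto intro: finite_subset[of _ "{..<x}"])
qed

text \<open>There is no carry: \<open>u\<close> and the next power of two above it are multiples of
  \<open>2 ^ low u\<close>, so they differ by at least that much, while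
  \<open>x < 2 ^ low u\<close>. Likewise \<open>2 ^ Suc (low x)\<close> divides \<open>u\<close>, so
  the lowest digit of \<open>x\<close> is untouched.\<close>

lemma
  assumes "0 < x" "0 < u" "high x < low u"
  shows high_add: "high (x + u) = high u"
    and low_add: "low (x + u) = low x"
proof -
  have "2 ^ Suc (high x) \<le> (2::nat) ^ low u" using assms(3) by (intro power_increasing) auto
  then have x: "x < 2 ^ low u" using high_bounds(2)[OF assms(1)] by linarith
  obtain k where k: "u = 2 ^ low u * k" using low_dvd(1)[OF assms(2)] ..
  define d where "d = Suc (high u) - low u"
  have d: "(2::nat) ^ Suc (high u) = 2 ^ low u * 2 ^ d"
    using low_le_high[OF assms(2)] by (simp add: d_def flip: power_add)
  have "2 ^ low u * k < 2 ^ low u * (2::nat) ^ d"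
    using high_bounds(2)[OF assms(2)] k d by simp
  then have "Suc k \<le> 2 ^ d" by simp
  then have "2 ^ low u * Suc k \<le> 2 ^ low u * (2::nat) ^ d" by (rule mult_le_mono2)
  then have "2 ^ low u + u \<le> 2 ^ Suc (high u)" using k d by simp
  then show "high (x + u) = high u"
    using x high_bounds(1)[OF assms(2)] by (intro high_unique) auto
  have "Suc (low x) \<le> low u" using low_le_high[OF assms(1)] assms(3) by simp
  then have dvd: "2 ^ Suc (low x) dvd u"
    using low_dvd(1)[OF assms(2)] by (meson dvd_trans le_imp_power_dvd)
  then have "2 ^ low x dvd u" by (meson dvd_trans le_imp_power_dvd lessI less_imp_le)
  then show "low (x + u) = low x"
    using dvd low_dvd[OF assms(1)] by (intro low_unique) (auto simp: dvd_add_left_iff)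
qed

lemma low_power2: "low (2 ^ n) = n"
  by (rule low_unique) (auto dest: dvd_imp_le)

lemma low_strip_high:
  assumes "0 < u - 2 ^ high u"
  shows "low (u - 2 ^ high u) = low u" "high (u - 2 ^ high u) < high u"
proof -
  let ?u = "u - 2 ^ high u"
  have u: "0 < u" using assms by simp
  have "?u < 2 ^ high u" using high_bounds(2)[OF u] assms by simp
  moreover have "2 ^ high ?u \<le> ?u" by (rule high_bounds(1)[OF assms])
  ultimately have "(2::nat) ^ high ?u < 2 ^ high u" by linarith
  then show hi: "high ?u < high u" by (rule power_less_imp_less_exp[rotated]) simp
  have "low (?u + 2 ^ high u) = low ?u"
    using hi assms by (intro low_add) (simp_all add: low_power2)
  moreover have "?u + 2 ^ high u = u" using high_bounds(1)[OF u] by simp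
  ultimately show "low ?u = low u" by simp
qed

lemma rc_high: "rc f \<Longrightarrow> rc (\<lambda>v. high (f v))"
  by (rule rc_comp[of high]) (unfold high_def, intro rc_intros)

lemma rc_low: "rc f \<Longrightarrow> rc (\<lambda>v. low (f v))"
  by (rule rc_comp[of low]) (unfold low_def, intro rc_intros)

subsection \<open>The colouring\<close>

text \<open>\<open>b\<close> bounds the witnesses \<open>j\<close>, and \<open>t\<close> the search
  for counterexamples. Growth of \<open>t\<close> can only destroy survival and growth of
  \<open>b\<close> can only restore it, hence two separate limits.\<close>

definition surv :: "nat \<Rightarrow> nat \<Rightarrow> nat \<Rightarrow> nat \<Rightarrow> nat \<Rightarrow> bool" where
  "surv e x a b t \<longleftrightarrow> (\<forall>i\<le>a. \<exists>j\<le>b. \<not> refuted e x i j t)"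

lemma surv_antimono: "surv e x a b t \<Longrightarrow> a' \<le> a \<Longrightarrow> surv e x a' b t"
  unfolding surv_def by (meson le_trans)

text \<open>A search value of \<open>Suc m\<close> is the default: no admissible
  \<open>x \<le> m\<close> exists and index \<open>e\<close> claims nothing.\<close>

primrec sel :: "(nat \<Rightarrow> nat \<Rightarrow> bool) \<Rightarrow> nat \<Rightarrow> nat \<Rightarrow> (nat \<times> nat) list" where
  "sel Q m 0 = []"
| "sel Q m (Suc e) =
    (let x = bmin (Suc m) (\<lambda>x. 0 < x \<and> Q e x \<and> \<not> (\<exists>p\<in>set (sel Q m e). snd p = low x))
     in if x \<le> m then (e, low x) # sel Q m e else sel Q m e)"

text \<open>The depth at which all rivals in \<open>B\<^sup>a\<close> have died is not known in
  advance, so any depth \<open>i \<le> b\<close> is accepted.\<close>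

definition sole :: "nat \<Rightarrow> nat \<Rightarrow> nat \<Rightarrow> nat \<Rightarrow> nat \<Rightarrow> bool" where
  "sole e a b t y \<longleftrightarrow> 2 ^ a \<le> y \<and> y < 2 ^ Suc a \<and>
    (\<exists>i\<le>b. surv e y i b t \<and> (\<forall>z<2 ^ Suc a. 2 ^ a \<le> z \<and> z \<noteq> y \<longrightarrow> \<not> surv e z i b t))"

text \<open>Course-of-values recursion: \<open>P n W\<close> decides \<open>n\<close> given the list \<open>W\<close> of all smaller positive instances.\<close>

primrec cov :: "(nat \<Rightarrow> nat list \<Rightarrow> bool) \<Rightarrow> nat \<Rightarrow> nat list" where
  "cov P 0 = []"
| "cov P (Suc n) = (if P n (cov P n) then n # cov P n else cov P n)"

lemma mem_cov: "k \<in> set (cov P n) \<longleftrightarrow> k < n \<and> P k (cov P k)"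
  by (induction n) (auto simp: less_Suc_eq)

text \<open>Charges of gaps and parities of charges depend on each other. Reading the parities from
  a list \<open>W\<close> breaks the circle; \<open>charged\<close> is the version with the actual
  parities.\<close>

definition charged_wrt :: "nat \<Rightarrow> nat \<Rightarrow> nat list \<Rightarrow> nat \<Rightarrow> nat \<Rightarrow> bool" where
  "charged_wrt l t W a b \<longleftrightarrow> (\<exists>e\<le>a. (e, l) \<in> set (sel (\<lambda>e x. surv e x a b t) a (Suc a)) \<and>
    (\<exists>y<2 ^ Suc a. sole e a b t y \<and> y \<notin> set W))"

definition charge_step :: "nat \<Rightarrow> nat \<Rightarrow> nat \<Rightarrow> nat list \<Rightarrow> bool" where
  "charge_step l t x W \<longleftrightarrow> x - 2 ^ high x \<noteq> 0 \<and>
    (x - 2 ^ high x \<in> set W) \<noteq> charged_wrt l t W (high (x - 2 ^ high x)) (high x)"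

definition odd_charge :: "nat \<Rightarrow> nat \<Rightarrow> nat \<Rightarrow> bool" where
  "odd_charge l t x \<longleftrightarrow> x \<in> set (cov (charge_step l t) (Suc x))"

definition charged :: "nat \<Rightarrow> nat \<Rightarrow> nat \<Rightarrow> nat \<Rightarrow> bool" where
  "charged l t a b \<longleftrightarrow> (\<exists>e\<le>a. (e, l) \<in> set (sel (\<lambda>e x. surv e x a b t) a (Suc a)) \<and>
    (\<exists>y<2 ^ Suc a. sole e a b t y \<and> \<not> odd_charge l t y))"

definition colour :: "nat \<Rightarrow> nat" where
  "colour w = (if odd_charge (low w) (high w) w then 1 else 0)"

text \<open>The list of smaller instances suffices: if \<open>a\<close> is the second highest digit
  of \<open>x\<close>, every \<open>y < 2 ^ Suc a\<close> consulted for the top gap lies below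
  \<open>x\<close>.\<close>

lemma odd_charge_rec:
  "odd_charge l t x \<longleftrightarrow> x - 2 ^ high x \<noteq> 0 \<and>
    odd_charge l t (x - 2 ^ high x) \<noteq> charged l t (high (x - 2 ^ high x)) (high x)"
proof -
  let ?x = "x - 2 ^ high x" and ?W = "cov (charge_step l t) x"
  have W: "y \<in> set ?W \<longleftrightarrow> y < x \<and> odd_charge l t y" for y
    by (auto simp: odd_charge_def mem_cov simp del: cov.simps)
  have "odd_charge l t x \<longleftrightarrow> charge_step l t x ?W"
    by (simp add: odd_charge_def mem_cov del: cov.simps)
  moreover have "charge_step l t x ?W \<longleftrightarrow>
      ?x \<noteq> 0 \<and> odd_charge l t ?x \<noteq> charged l t (high ?x) (high x)"
  proof (cases "?x = 0")
    case False
    then have x: "0 < x" "0 < ?x" by simp_all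
    have "2 ^ Suc (high ?x) \<le> (2::nat) ^ high x"
      using low_strip_high(2)[OF x(2)] by (intro power_increasing) auto
    then have "2 ^ Suc (high ?x) \<le> x" using high_bounds(1)[OF x(1)] by linarith
    then have "y \<in> set ?W \<longleftrightarrow> odd_charge l t y" if "y < 2 ^ Suc (high ?x)" for y
      using that by (simp add: W)
    then have "charged_wrt l t ?W (high ?x) (high x) = charged l t (high ?x) (high x)"
      unfolding charged_wrt_def charged_def by (intro ex_cong1 conj_cong refl) blast
    moreover have "?x \<in> set ?W \<longleftrightarrow> odd_charge l t ?x" using x by (simp add: W)
    ultimately show ?thesis by (simp add: charge_step_def)
  qed (simp add: charge_step_def)
  ultimately show ?thesis by simp
qed

text \<open>With \<open>l\<close> and \<open>t\<close> fixed, a charge depends on the gap alone, and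
  placing \<open>u\<close> above \<open>x\<close> creates only the gap
  \<open>(high x, low u)\<close>. The induction strips the top digit of \<open>u\<close>; inequality
  of truth values is addition modulo 2.\<close>

lemma odd_charge_add:
  assumes "0 < x" "0 < u" "high x < low u"
  shows "odd_charge l t (x + u) \<longleftrightarrow>
    (odd_charge l t x \<noteq> (charged l t (high x) (low u) \<noteq> odd_charge l t u))"
  using assms(2,3)
proof (induction u rule: less_induct)
  case (less u)
  let ?u = "u - 2 ^ high u"
  have hi: "high (x + u) = high u" by (rule high_add[OF assms(1) less.prems])
  have le: "2 ^ high u \<le> u" by (rule high_bounds(1)[OF less.prems(1)])
  then have strip: "x + u - 2 ^ high u = x + ?u" by simp
  show ?case
  proof (cases "?u = 0")
    case True
    then have "u = 2 ^ high u" using le by simp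
    then have "low u = high u" by (metis low_power2)
    then show ?thesis
      using True assms(1) odd_charge_rec[of l t "x + u"] odd_charge_rec[of l t u]
      by (simp add: hi strip)
  next
    case False
    then have u: "0 < ?u" by simp
    note lo = low_strip_high[OF u]
    have "odd_charge l t (x + ?u) \<longleftrightarrow>
        (odd_charge l t x \<noteq> (charged l t (high x) (low u) \<noteq> odd_charge l t ?u))"
      using less.IH[of ?u] u less.prems lo(1) by simp
    moreover have "high (x + ?u) = high ?u"
      using high_add[OF assms(1) u] lo(1) less.prems(2) by simp
    ultimately show ?thesis
      using u assms(1) odd_charge_rec[of l t "x + u"] odd_charge_rec[of l t u]
      unfolding hi strip by (metis add_gr_0 less_numeral_extra(3))
  qed
qed

section \<open>Recursiveness of the colouring\<close>

lemma rc_comp5: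
  assumes "rc (\<lambda>(e, x, a, b, t). h e x a b t)" "rc e" "rc x" "rc a" "rc b" "rc t"
  shows "rc (\<lambda>v. h (e v) (x v) (a v) (b v) (t v))"
  using rc_comp[OF assms(1) rc_Pair[OF assms(2) rc_Pair[OF assms(3) rc_Pair[OF assms(4)
    rc_Pair[OF assms(5,6)]]]]] by simp

lemma rc_refuted:
  "rc e \<Longrightarrow> rc x \<Longrightarrow> rc a \<Longrightarrow> rc b \<Longrightarrow> rc t \<Longrightarrow> rc (\<lambda>v. refuted (e v) (x v) (a v) (b v) (t v))"
  by (rule rc_comp5[of refuted])
    (unfold refuted_def split_beta, intro rc_intros rc_valid rc_inv_enc surj_enc_entries)

lemma rc_surv:
  "rc e \<Longrightarrow> rc x \<Longrightarrow> rc a \<Longrightarrow> rc b \<Longrightarrow> rc t \<Longrightarrow> rc (\<lambda>v. surv (e v) (x v) (a v) (b v) (t v))"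
  by (rule rc_comp5[of surv]) (unfold surv_def split_beta, intro rc_intros rc_refuted)

lemma rc_sole:
  "rc e \<Longrightarrow> rc a \<Longrightarrow> rc b \<Longrightarrow> rc t \<Longrightarrow> rc y \<Longrightarrow> rc (\<lambda>v. sole (e v) (a v) (b v) (t v) (y v))"
  by (rule rc_comp5[of sole]) (unfold sole_def split_beta, intro rc_intros rc_surv)

lemma rc_sel:
  fixes Q :: "nat \<Rightarrow> nat \<Rightarrow> 'a::enc \<Rightarrow> bool"
  assumes "rc (\<lambda>u. Q (fst u) (fst (snd u)) (snd (snd u)))" "rc m" "rc n"
  shows "rc (\<lambda>v. sel (\<lambda>e x. Q e x v) (m v) (n v))"
proof -
  let ?b = "\<lambda>e L v. bmin (Suc (m v)) (\<lambda>x. 0 < x \<and> Q e x v \<and> \<not> (\<exists>p\<in>set L. snd p = low x))"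
  have "rc (\<lambda>v. rec_nat [] (\<lambda>e L. if ?b e L v \<le> m v then (e, low (?b e L v)) # L else L) (n v))"
    by (intro rc_rec_nat rc_intros rc_low assms(3) rc_comp[OF assms(2)] rc_comp3[OF assms(1)])
  moreover have "rec_nat [] (\<lambda>e L. if ?b e L v \<le> m v then (e, low (?b e L v)) # L else L) k
      = sel (\<lambda>e x. Q e x v) (m v) k" for v k
    by (induction k) (simp_all add: Let_def)
  ultimately show ?thesis by simp
qed

declare sel.simps(2) [simp del]

lemma rc_cov:
  fixes P :: "nat \<Rightarrow> nat list \<Rightarrow> 'a::enc \<Rightarrow> bool"
  assumes "rc (\<lambda>u. P (fst u) (fst (snd u)) (snd (snd u)))" "rc n"
  shows "rc (\<lambda>v. cov (\<lambda>k W. P k W v) (n v))"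
proof -
  have "rc (\<lambda>v. rec_nat [] (\<lambda>k W. if P k W v then k # W else W) (n v))"
    by (intro rc_rec_nat rc_intros assms(2) rc_comp3[OF assms(1)])
  moreover have "rec_nat [] (\<lambda>k W. if P k W v then k # W else W) i = cov (\<lambda>k W. P k W v) i" for v i
    by (induction i) simp_all
  ultimately show ?thesis by simp
qed

lemma rc_charged_wrt:
  "rc l \<Longrightarrow> rc t \<Longrightarrow> rc W \<Longrightarrow> rc a \<Longrightarrow> rc b \<Longrightarrow>
    rc (\<lambda>v. charged_wrt (l v) (t v) (W v) (a v) (b v))"
  by (rule rc_comp5[of charged_wrt])
    (unfold charged_wrt_def split_beta, intro rc_intros rc_sel rc_surv rc_sole)

lemma recursive_colour: "recursive_fun colour"
proof -
  have step: "rc (\<lambda>u. charge_step (low (snd (snd u))) (high (snd (snd u))) (fst u) (fst (snd u)))"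
    unfolding charge_step_def by (intro rc_intros rc_charged_wrt rc_low rc_high)
  have "rc (\<lambda>w. if w \<in> set (cov (\<lambda>x W. charge_step (low w) (high w) x W) (Suc w)) then 1 else 0 :: nat)"
    by (intro rc_if rc_mem rc_cov step rc_Suc rc_id rc_const)
  then show ?thesis
    by (simp add: rc_def recursive_fun_def colour_def[abs_def] odd_charge_def)
qed

subsection \<open>Selection of lowest digits\<close>

lemma bmin_cong: "(\<And>i. i < n \<Longrightarrow> P i = Q i) \<Longrightarrow> bmin n P = bmin n Q"
proof (induction n)
  case (Suc n)
  have "bmin n Q \<le> n" using bmin_cases[of n Q] by auto
  with Suc show ?case by (simp add: bmin.simps)
qed (simp add: bmin.simps)

text \<open>Only a finite box of values of \<open>Q\<close> is consulted, so pointwise limits of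
  predicates carry over to \<open>sel\<close>.\<close>

lemma sel_cong:
  "(\<And>e x. e < n \<Longrightarrow> x \<le> m \<Longrightarrow> Q e x = Q' e x) \<Longrightarrow> sel Q m n = sel Q' m n"
proof (induction n)
  case (Suc n)
  then have IH: "sel Q m n = sel Q' m n" by simp
  have "bmin (Suc m) (\<lambda>x. 0 < x \<and> Q n x \<and> \<not> (\<exists>p\<in>set (sel Q' m n). snd p = low x)) =
    bmin (Suc m) (\<lambda>x. 0 < x \<and> Q' n x \<and> \<not> (\<exists>p\<in>set (sel Q' m n). snd p = low x))"
    using Suc.prems by (intro bmin_cong) auto
  then show ?case by (simp only: sel.simps IH)
qed simp

lemma sel_Suc_cases:
  obtains "sel Q m (Suc e) = sel Q m e"
  | x where "sel Q m (Suc e) = (e, low x) # sel Q m e" "low x \<notin> snd ` set (sel Q m e)"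
proof -
  let ?P = "\<lambda>x. 0 < x \<and> Q e x \<and> \<not> (\<exists>p\<in>set (sel Q m e). snd p = low x)"
  show thesis
  proof (cases "bmin (Suc m) ?P \<le> m")
    case True
    then have "?P (bmin (Suc m) ?P)" using bmin_works[of "Suc m" ?P] by simp
    then show thesis
      using True by (intro that(2)[of "bmin (Suc m) ?P"]) (auto simp: sel.simps(2) Let_def)
  next
    case False
    then show thesis by (intro that(1)) (simp add: sel.simps(2) Let_def)
  qed
qed

lemma set_sel_mono: "n \<le> n' \<Longrightarrow> set (sel Q m n) \<subseteq> set (sel Q m n')"
proof (induction n' rule: dec_induct)
  case (step k)
  then show ?case by (cases rule: sel_Suc_cases[of Q m k]) auto
qed simp

lemma length_sel_le: "length (sel Q m n) \<le> n"
proof (induction n)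
  case (Suc n)
  then show ?case by (cases rule: sel_Suc_cases[of Q m n]) auto
qed simp

text \<open>No digit is claimed twice; this lets a colouring that sees only \<open>l\<close> recover
  the index \<open>e\<close>.\<close>

lemma sel_inj: "(e, l) \<in> set (sel Q m n) \<Longrightarrow> (e', l) \<in> set (sel Q m n) \<Longrightarrow> e = e'"
proof (induction n)
  case (Suc n)
  then show ?case by (cases rule: sel_Suc_cases[of Q m n]) (auto simp: image_iff)
qed simp

text \<open>The smaller indices hold at most \<open>e\<close> digits, so some digit in
  \<open>Y\<close> is still free at the turn of \<open>e\<close>. Hence an admissible
  \<open>x \<le> N\<close> exists, and the least one is taken.\<close>

lemma sel_hits:
  assumes "e < card Y" "finite Y" "N \<le> m"
    and Y: "\<And>l. l \<in> Y \<Longrightarrow> \<exists>x\<le>N. 0 < x \<and> Q e x \<and> low x = l"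
  shows "\<exists>x\<le>N. 0 < x \<and> Q e x \<and> (e, low x) \<in> set (sel Q m (Suc e))"
proof -
  let ?P = "\<lambda>x. 0 < x \<and> Q e x \<and> \<not> (\<exists>p\<in>set (sel Q m e). snd p = low x)"
  have "card (snd ` set (sel Q m e)) \<le> e"
    using card_image_le[of "set (sel Q m e)" snd] card_length[of "sel Q m e"] length_sel_le[of Q m e]
    by simp
  then have "\<not> Y \<subseteq> snd ` set (sel Q m e)"
    using assms(1) card_mono[of "snd ` set (sel Q m e)" Y] by fastforce
  then obtain x where x: "x \<le> N" "?P x" using Y by force
  let ?x = "bmin (Suc m) ?P"
  have le: "?x \<le> N" using bmin_le[of ?P, OF x(2), of "Suc m"] x(1) by simp
  then have "?P ?x" using assms(3) bmin_works[of "Suc m" ?P] by simp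
  moreover have "(e, low ?x) \<in> set (sel Q m (Suc e))"
    using le assms(3) by (simp add: sel.simps(2) Let_def)
  ultimately show ?thesis using le by blast
qed

text \<open>Of the two depths take the smaller: the survivor at the larger depth survives there as
  well, and so is a forbidden rival.\<close>

lemma sole_unique:
  assumes "sole e a b t y" "sole e a b t z"
  shows "y = z"
proof (rule ccontr)
  assume "y \<noteq> z"
  obtain i where i: "surv e y i b t" "\<forall>w<2 ^ Suc a. 2 ^ a \<le> w \<and> w \<noteq> y \<longrightarrow> \<not> surv e w i b t"
    using assms(1) by (auto simp: sole_def)
  obtain j where j: "surv e z j b t" "\<forall>w<2 ^ Suc a. 2 ^ a \<le> w \<and> w \<noteq> z \<longrightarrow> \<not> surv e w j b t"
    using assms(2) by (auto simp: sole_def)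
  have "\<not> surv e z i b t" "\<not> surv e y j b t"
    using i(2) j(2) assms \<open>y \<noteq> z\<close> by (auto simp: sole_def)
  then show False
    using i(1) j(1) surv_antimono nat_le_linear by blast
qed

subsection \<open>Limits of the approximations\<close>

text \<open>The order matters: the threshold for \<open>t\<close> may depend on
  \<open>b\<close>.\<close>

abbreviation ev2 :: "(nat \<Rightarrow> nat \<Rightarrow> bool) \<Rightarrow> bool" where
  "ev2 P \<equiv> \<forall>\<^sub>F b in sequentially. \<forall>\<^sub>F t in sequentially. P b t"

lemma ev2_ball:
  assumes "finite I" "\<And>i. i \<in> I \<Longrightarrow> ev2 (P i)"
  shows "ev2 (\<lambda>b t. \<forall>i\<in>I. P i b t)"
proof -
  have "\<forall>\<^sub>F b in sequentially. \<forall>i\<in>I. \<forall>\<^sub>F t in sequentially. P i b t"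
    using assms by (simp add: eventually_ball_finite)
  then show ?thesis
    by eventually_elim (simp add: assms(1) eventually_ball_finite)
qed

lemma ev2_conj:
  assumes "ev2 P" "ev2 Q"
  shows "ev2 (\<lambda>b t. P b t \<and> Q b t)"
  using assms by eventually_elim (rule eventually_conj)

lemma ev2_mono:
  assumes "ev2 P" "\<And>b t. P b t \<Longrightarrow> Q b t"
  shows "ev2 Q"
  using assms(1) by eventually_elim (auto elim: eventually_mono intro: assms(2))

definition survives :: "nat \<Rightarrow> nat \<Rightarrow> nat \<Rightarrow> bool" where
  "survives e x a \<longleftrightarrow> (\<forall>i\<le>a. \<exists>j. \<forall>t. \<not> refuted e x i j t)"

text \<open>If condition \<open>i\<close> has a witness \<open>j\<close>, every
  \<open>b \<ge> j\<close> will do. Otherwise each of the finitely many \<open>j \<le> b\<close> is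
  refuted at some stage, and by monotonicity all of them are for large \<open>t\<close>.\<close>

lemma ev2_surv: "ev2 (\<lambda>b t. surv e x a b t \<longleftrightarrow> survives e x a)"
proof -
  have "ev2 (\<lambda>b t. (\<exists>j\<le>b. \<not> refuted e x i j t) \<longleftrightarrow> (\<exists>j. \<forall>t. \<not> refuted e x i j t))" for i
  proof (cases "\<exists>j. \<forall>t. \<not> refuted e x i j t")
    case True
    then obtain j where j: "\<forall>t. \<not> refuted e x i j t" by blast
    have "\<forall>\<^sub>F b in sequentially. j \<le> b" by (rule eventually_ge_at_top)
    then show ?thesis
      by eventually_elim (use True j in \<open>auto intro!: always_eventually\<close>)
  next
    case False
    have "\<forall>\<^sub>F t in sequentially. \<forall>j\<in>{..b}. refuted e x i j t" for b
    proof (rule eventually_ball_finite)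
      show "\<forall>j\<in>{..b}. \<forall>\<^sub>F t in sequentially. refuted e x i j t"
        using False refuted_mono unfolding eventually_sequentially by metis
    qed simp
    then have "\<forall>\<^sub>F t in sequentially. (\<exists>j\<le>b. \<not> refuted e x i j t) \<longleftrightarrow>
        (\<exists>j. \<forall>t. \<not> refuted e x i j t)" for b
      by (rule eventually_mono) (use False in auto)
    then show ?thesis by simp
  qed
  then have "ev2 (\<lambda>b t. \<forall>i\<in>{..a}. (\<exists>j\<le>b. \<not> refuted e x i j t) \<longleftrightarrow> (\<exists>j. \<forall>t. \<not> refuted e x i j t))"
    by (intro ev2_ball) simp_all
  then show ?thesis
    by (rule ev2_mono) (auto simp: surv_def survives_def)
qed

text \<open>Every other number with highest digit \<open>high s\<close> lies outside
  \<open>A\<close> and fails at some depth. There are finitely many, so one depth \<open>i\<close>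
  serves for all, and \<open>b \<ge> i\<close> admits it.\<close>

lemma ev2_sole:
  assumes inj: "\<And>x y. x \<in> A \<Longrightarrow> y \<in> A \<Longrightarrow> 0 < x \<Longrightarrow> 0 < y \<Longrightarrow> high x = high y \<Longrightarrow> x = y"
    and A: "\<And>x. x \<in> A \<longleftrightarrow> (\<forall>a. survives e x a)"
    and s: "s \<in> A" "0 < s"
  shows "ev2 (\<lambda>b t. sole e (high s) b t s)"
proof -
  let ?m = "high s"
  let ?B = "{z. z < 2 ^ Suc ?m \<and> 2 ^ ?m \<le> z \<and> z \<noteq> s}"
  have fin: "finite ?B" by simp
  have "z \<notin> A" if "z \<in> ?B" for z
  proof
    assume "z \<in> A"
    have "high z = ?m" using that by (intro high_unique) auto
    moreover have "0 < z" using that by (cases z) auto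
    ultimately show False using inj[OF \<open>z \<in> A\<close> s(1)] s(2) that by blast
  qed
  then have "\<forall>z\<in>?B. \<exists>a. \<not> survives e z a" using A by blast
  then obtain a where a: "\<forall>z\<in>?B. \<not> survives e z (a z)" by metis
  have "\<exists>i. \<forall>z\<in>?B. a z \<le> i"
    by (intro exI[of _ "Max (a ` ?B)"] ballI Max_ge finite_imageI fin imageI)
  then obtain i where i: "\<forall>z\<in>?B. a z \<le> i" by blast
  have dead: "\<not> survives e z i" if "z \<in> ?B" for z
    using a i that unfolding survives_def by (meson le_trans)
  have "ev2 (\<lambda>b t. \<forall>z\<in>insert s ?B. surv e z i b t \<longleftrightarrow> survives e z i)"
    using fin by (intro ev2_ball ev2_surv) simp
  moreover have "ev2 (\<lambda>b t. i \<le> b)"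
    by (rule eventually_mono[OF eventually_ge_at_top[of i]]) simp
  ultimately have "ev2 (\<lambda>b t. (\<forall>z\<in>insert s ?B. surv e z i b t \<longleftrightarrow> survives e z i) \<and> i \<le> b)"
    by (rule ev2_conj)
  then show ?thesis
  proof (rule ev2_mono)
    fix b t
    assume *: "(\<forall>z\<in>insert s ?B. surv e z i b t \<longleftrightarrow> survives e z i) \<and> i \<le> b"
    have "surv e s i b t" using * A s(1) by blast
    moreover have "\<forall>z<2 ^ Suc ?m. 2 ^ ?m \<le> z \<and> z \<noteq> s \<longrightarrow> \<not> surv e z i b t"
      using * dead by blast
    ultimately show "sole e ?m b t s"
      unfolding sole_def using * high_bounds[OF s(2)] by blast
  qed
qed

text \<open>In the limit \<open>sel\<close> yields the true claims at stage \<open>high s\<close>,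
  where \<open>l\<close> belongs to \<open>e\<close> alone, and \<open>s\<close> is the sole
  survivor for \<open>e\<close>. So \<open>e\<close> and \<open>s\<close> are the only candidates
  for the two existential quantifiers in \<open>charged\<close>.\<close>

lemma ev2_charged:
  assumes s: "ev2 (\<lambda>b t. sole e (high s) b t s)" "0 < s"
    and l: "(e, l) \<in> set (sel (\<lambda>e x. survives e x (high s)) (high s) (Suc (high s)))"
    and e: "e \<le> high s"
  shows "ev2 (\<lambda>b t. charged l t (high s) b \<longleftrightarrow> \<not> odd_charge l t s)"
proof -
  let ?m = "high s"
  let ?I = "{..?m} \<times> {..?m}"
  have "ev2 (\<lambda>b t. \<forall>p\<in>?I. surv (fst p) (snd p) ?m b t \<longleftrightarrow> survives (fst p) (snd p) ?m)"
    by (intro ev2_ball ev2_surv) simp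
  then have "ev2 (\<lambda>b t. (\<forall>p\<in>?I. surv (fst p) (snd p) ?m b t \<longleftrightarrow> survives (fst p) (snd p) ?m) \<and>
      sole e ?m b t s)"
    using s(1) by (rule ev2_conj)
  then show ?thesis
  proof (rule ev2_mono)
    fix b t
    assume *: "(\<forall>p\<in>?I. surv (fst p) (snd p) ?m b t \<longleftrightarrow> survives (fst p) (snd p) ?m) \<and>
      sole e ?m b t s"
    then have "surv e' x ?m b t \<longleftrightarrow> survives e' x ?m" if "e' < Suc ?m" "x \<le> ?m" for e' x
      using that by (simp add: less_Suc_eq_le)
    then have "sel (\<lambda>e x. surv e x ?m b t) ?m (Suc ?m) = sel (\<lambda>e x. survives e x ?m) ?m (Suc ?m)"
      by (intro sel_cong) auto
    with l have mem: "(e, l) \<in> set (sel (\<lambda>e x. surv e x ?m b t) ?m (Suc ?m))" by (simp only:)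
    then have "e' = e" if "(e', l) \<in> set (sel (\<lambda>e x. surv e x ?m b t) ?m (Suc ?m))" for e'
      using that sel_inj by blast
    moreover have "y = s" if "sole e ?m b t y" for y using * that sole_unique by blast
    ultimately show "charged l t ?m b \<longleftrightarrow> \<not> odd_charge l t s"
      unfolding charged_def using mem * e high_bounds(2)[OF s(2)] by blast
  qed
qed

subsection \<open>Weakly apart sets\<close>

lemma weak_apart_refutes_homogeneity:
  assumes pos: "A \<subseteq> {0<..}" and inf: "infinite A" and wa: "weak_apart A"
    and A: "\<And>x. x \<in> A \<longleftrightarrow> (\<forall>a. survives e x a)"
  shows "\<exists>w1\<in>FS A. \<exists>w2\<in>FS A. colour w1 \<noteq> colour w2"
proof -
  have pos': "0 < x" if "x \<in> A" for x using that pos by auto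
  have inj: "x = y" if "x \<in> A" "y \<in> A" "high x = high y" for x y
    using wa that pos' by (metis mu_eq_high weak_apart_def)
  have fibre: "finite {x \<in> A. low x = l}" for l
  proof -
    have "{x \<in> A. low x = l} = {x \<in> A. lam x = l}" using pos' by (auto simp: lam_eq_low)
    then show ?thesis using wa by (simp add: weak_apart_def)
  qed
  have large: "\<exists>x\<in>B. n < low x" if "infinite B" "B \<subseteq> A" for B n
  proof (rule ccontr)
    assume "\<not> (\<exists>x\<in>B. n < low x)"
    then have "B \<subseteq> (\<Union>l\<in>{..n}. {x \<in> A. low x = l})" using that(2) by (auto simp: not_less)
    then show False using that(1) fibre by (meson finite_UN_I finite_atMost finite_subset)
  qed
  have "infinite (low ` A)"
    using pigeonhole_infinite[OF inf, of low] fibre by blast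
  \<comment> \<open>One digit more than the smaller indices can block.\<close>
  then obtain Y where Y: "finite Y" "card Y = Suc e" "Y \<subseteq> low ` A"
    using infinite_arbitrarily_large by blast
  obtain X where X: "X \<subseteq> A" "finite X" "Y = low ` X"
    using finite_subset_image[OF Y(1,3)] by blast
  obtain N where N: "\<And>x. x \<in> X \<Longrightarrow> x \<le> N"
    using X(2) Max_ge by blast
  have "\<forall>\<^sub>F m in sequentially. \<forall>x\<in>{..N}. survives e x m \<longleftrightarrow> x \<in> A"
  proof (rule eventually_ball_finite)
    show "\<forall>x\<in>{..N}. \<forall>\<^sub>F m in sequentially. survives e x m \<longleftrightarrow> x \<in> A"
    proof
      fix x
      show "\<forall>\<^sub>F m in sequentially. survives e x m \<longleftrightarrow> x \<in> A"
      proof (cases "x \<in> A")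
        case True
        then show ?thesis using A by simp
      next
        case False
        then obtain a where "\<not> survives e x a" using A by blast
        then have "\<forall>m\<ge>a. \<not> survives e x m" unfolding survives_def by (meson le_trans)
        then show ?thesis using False by (auto simp: eventually_sequentially)
      qed
    qed
  qed simp
  then obtain m0 where m0: "\<And>m x. m0 \<le> m \<Longrightarrow> x \<le> N \<Longrightarrow> survives e x m \<longleftrightarrow> x \<in> A"
    unfolding eventually_sequentially by auto
  \<comment> \<open>From \<open>M\<close> on, membership up to \<open>N\<close> is settled, all
    candidates up to \<open>N\<close> are searched, and index \<open>e\<close> gets its
    turn.\<close>
  define M where "M = max m0 (max N e)"
  let ?sel = "\<lambda>m. set (sel (\<lambda>e x. survives e x m) m (Suc m))"
  have hit: "\<exists>k\<in>{k \<in> A. k \<le> N}. (e, low k) \<in> ?sel m" if "M \<le> m" for m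
  proof -
    have "\<exists>x\<le>N. 0 < x \<and> survives e x m \<and> (e, low x) \<in> set (sel (\<lambda>e x. survives e x m) m (Suc e))"
    proof (rule sel_hits[of e Y N m "\<lambda>e x. survives e x m"])
      show "\<exists>x\<le>N. 0 < x \<and> survives e x m \<and> low x = l" if l: "l \<in> Y" for l
      proof -
        obtain x where "x \<in> X" "low x = l" using l X(3) by auto
        then show ?thesis using X(1) N A pos' by (intro exI[of _ x]) auto
      qed
    qed (use Y that in \<open>auto simp: M_def\<close>)
    then obtain x where "x \<le> N" "survives e x m"
      "(e, low x) \<in> set (sel (\<lambda>e x. survives e x m) m (Suc e))" by blast
    moreover have "x \<in> A" using m0 calculation(1,2) that by (simp add: M_def)
    moreover have "set (sel (\<lambda>e x. survives e x m) m (Suc e)) \<subseteq> ?sel m"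
      using that by (intro set_sel_mono) (simp add: M_def)
    ultimately show ?thesis by blast
  qed
  have "{x \<in> A. high x < M} \<subseteq> {..<2 ^ M}"
  proof clarify
    fix x
    assume x: "x \<in> A" "high x < M"
    have "(2::nat) ^ Suc (high x) \<le> 2 ^ M" using x(2) by (intro power_increasing) auto
    then show "x < 2 ^ M" using high_bounds(2)[OF pos'[OF x(1)]] by linarith
  qed
  then have "finite {x \<in> A. high x < M}" by (rule finite_subset) simp
  then have "infinite (A - {x \<in> A. high x < M})" using inf by (rule Diff_infinite_finite)
  moreover have "finite {k \<in> A. k \<le> N}" by simp
  moreover have "\<forall>x\<in>A - {x \<in> A. high x < M}. \<exists>k\<in>{k \<in> A. k \<le> N}. (e, low k) \<in> ?sel (high x)"
  proof
    fix x
    assume "x \<in> A - {x \<in> A. high x < M}"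
    then have "M \<le> high x" by auto
    then show "\<exists>k\<in>{k \<in> A. k \<le> N}. (e, low k) \<in> ?sel (high x)" by (rule hit)
  qed
  \<comment> \<open>Pigeonhole: one of the finitely many \<open>k\<close> serves infinitely many
    stages \<open>high x\<close> with \<open>x \<in> A\<close>.\<close>
  ultimately obtain k where k: "k \<in> A"
    and infk: "infinite {x \<in> A - {x \<in> A. high x < M}. (e, low k) \<in> ?sel (high x)}"
    using pigeonhole_infinite_rel[of "A - {x \<in> A. high x < M}" "{k \<in> A. k \<le> N}"
        "\<lambda>x k. (e, low k) \<in> ?sel (high x)"] by blast
  define l where "l = low k"
  define B where "B = {x \<in> A - {x \<in> A. high x < M}. (e, l) \<in> ?sel (high x)}"
  have B: "infinite B" "B \<subseteq> A" using infk by (auto simp: B_def l_def)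
  have flip: "ev2 (\<lambda>b t. charged l t (high s) b \<longleftrightarrow> \<not> odd_charge l t s)" if "s \<in> B" for s
  proof (rule ev2_charged)
    show "ev2 (\<lambda>b t. sole e (high s) b t s)"
      using that B(2) by (intro ev2_sole[of A] A) (auto intro: inj pos')
    show "0 < s" using that B(2) pos' by blast
    show "(e, l) \<in> ?sel (high s)" using that by (simp add: B_def)
    show "e \<le> high s" using that by (auto simp: B_def M_def)
  qed
  then have "\<forall>s\<in>B. \<exists>b0. \<forall>b\<ge>b0. \<forall>\<^sub>F t in sequentially. charged l t (high s) b \<longleftrightarrow> \<not> odd_charge l t s"
    by (simp add: eventually_sequentially)
  then obtain b0 where b0: "\<And>s b. s \<in> B \<Longrightarrow> b0 s \<le> b \<Longrightarrow>
      \<forall>\<^sub>F t in sequentially. charged l t (high s) b \<longleftrightarrow> \<not> odd_charge l t s"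
    by metis
  \<comment> \<open>Each lowest digit exceeds the preceding highest digit, which excludes carries,
    and the thresholds \<open>b0\<close> of the earlier candidates, which fixes the charges between
    candidates for large \<open>t\<close>.\<close>
  obtain s1 where s1: "s1 \<in> B" "high k < low s1" using large[OF B] by blast
  obtain s2 where s2: "s2 \<in> B" "max (high s1) (b0 s1) < low s2" using large[OF B] by blast
  obtain s3 where s3: "s3 \<in> B" "max (high s2) (max (b0 s1) (b0 s2)) < low s3"
    using large[OF B] by blast
  have "\<forall>\<^sub>F t in sequentially.
      (charged l t (high s1) (low s2) \<longleftrightarrow> \<not> odd_charge l t s1) \<and>
      (charged l t (high s1) (low s3) \<longleftrightarrow> \<not> odd_charge l t s1) \<and>
      (charged l t (high s2) (low s3) \<longleftrightarrow> \<not> odd_charge l t s2)"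
    using s1 s2 s3 by (intro eventually_conj b0) auto
  then obtain t0 where t0: "\<And>t. t0 \<le> t \<Longrightarrow>
      (charged l t (high s1) (low s2) \<longleftrightarrow> \<not> odd_charge l t s1) \<and>
      (charged l t (high s1) (low s3) \<longleftrightarrow> \<not> odd_charge l t s1) \<and>
      (charged l t (high s2) (low s3) \<longleftrightarrow> \<not> odd_charge l t s2)"
    unfolding eventually_sequentially by auto
  \<comment> \<open>\<open>r\<close> makes the common highest digit \<open>t\<close> of both sums
    exceed \<open>t0\<close>; it comes last because \<open>t0\<close> depends on the gaps already
    chosen.\<close>
  obtain r where r: "r \<in> A" "max (high s3) t0 < low r" using large[OF inf] by blast
  define t where "t = high r"
  have "t0 \<le> t" using r low_le_high[OF pos'[OF r(1)]] by (simp add: t_def)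
  note t = t0[OF this]
  have p: "0 < k" "0 < s1" "0 < s2" "0 < s3" "0 < r"
    using pos' k B(2) s1 s2 s3 r by blast+
  note lh = p[THEN low_le_high]
  have main: ?thesis
    if sA: "s \<in> A" and uA: "u \<in> A" and ks: "high k < low s" and su: "high s < low u"
      and ur: "high u < low r"
      and agree: "charged l t (high k) (low s) \<longleftrightarrow> charged l t (high k) (low u)"
      and diag: "charged l t (high s) (low u) \<longleftrightarrow> \<not> odd_charge l t s" for s u
  proof -
    have p: "0 < s" "0 < u" using sA uA pos' by blast+
    note lh' = p[THEN low_le_high]
    have ku: "high k < low u" using ks su lh' by linarith
    have lur: "low (u + r) = low u" "high (u + r) = t"
      using low_add[OF p(2) \<open>0 < r\<close> ur] high_add[OF p(2) \<open>0 < r\<close> ur] by (simp_all add: t_def)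
    have lsur: "low (s + (u + r)) = low s" "high (s + (u + r)) = t"
      using low_add[OF p(1), of "u + r"] high_add[OF p(1), of "u + r"] p su lur by simp_all
    have lk: "low (k + (s + (u + r))) = l" "high (k + (s + (u + r))) = t"
      "low (k + (u + r)) = l" "high (k + (u + r)) = t"
      using low_add[OF \<open>0 < k\<close>] high_add[OF \<open>0 < k\<close>] p ks ku lur lsur by (simp_all add: l_def)
    have "odd_charge l t (k + (s + (u + r))) \<longleftrightarrow>
        (odd_charge l t k \<noteq> (charged l t (high k) (low s) \<noteq> odd_charge l t (s + (u + r))))"
      using odd_charge_add[OF \<open>0 < k\<close>, of "s + (u + r)"] p ks lsur by simp
    moreover have "odd_charge l t (s + (u + r)) \<longleftrightarrow>
        (odd_charge l t s \<noteq> (charged l t (high s) (low u) \<noteq> odd_charge l t (u + r)))"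
      using odd_charge_add[OF p(1), of "u + r"] p su lur by simp
    moreover have "odd_charge l t (k + (u + r)) \<longleftrightarrow>
        (odd_charge l t k \<noteq> (charged l t (high k) (low u) \<noteq> odd_charge l t (u + r)))"
      using odd_charge_add[OF \<open>0 < k\<close>, of "u + r"] p ku lur by simp
    \<comment> \<open>Modulo 2 the two sides differ by the charges of
      \<open>(high k, low s)\<close>, \<open>(high s, low u)\<close>, \<open>(high k, low u)\<close>
      and the parity of \<open>s\<close>. The first and third cancel by \<open>agree\<close>; the
      other two add up to 1 by \<open>diag\<close>.\<close>
    ultimately have "odd_charge l t (k + (s + (u + r))) \<noteq> odd_charge l t (k + (u + r))"
      using agree diag by blast
    then have "colour (k + (s + (u + r))) \<noteq> colour (k + (u + r))"
      by (simp add: colour_def lk)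
    moreover have ne: "k \<noteq> s" "k \<noteq> u" "k \<noteq> r" "s \<noteq> u" "s \<noteq> r" "u \<noteq> r"
      using ks su ur ku lh lh' by auto
    have "k + (s + (u + r)) = \<Sum>{k, s, u, r}" "k + (u + r) = \<Sum>{k, u, r}"
      using ne by simp_all
    then have "k + (s + (u + r)) \<in> FS A" "k + (u + r) \<in> FS A"
      unfolding FS_def using k sA uA r(1)
      by (force intro!: exI[of _ "{k, s, u, r}"], force intro!: exI[of _ "{k, u, r}"])
    ultimately show ?thesis by blast
  qed
  \<comment> \<open>Two of the three truth values \<open>charged l t (high k) (low s\<^sub>i)\<close> agree.\<close>
  consider "charged l t (high k) (low s1) \<longleftrightarrow> charged l t (high k) (low s2)"
    | "charged l t (high k) (low s1) \<longleftrightarrow> charged l t (high k) (low s3)"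
    | "charged l t (high k) (low s2) \<longleftrightarrow> charged l t (high k) (low s3)"
    by blast
  then show ?thesis
  proof cases
    case 1
    show ?thesis
      by (rule main[of s1 s2]) (use 1 s1 s2 s3 r t B(2) lh in auto)
  next
    case 2
    show ?thesis
      by (rule main[of s1 s3]) (use 2 s1 s2 s3 r t B(2) lh in auto)
  next
    case 3
    show ?thesis
      by (rule main[of s2 s3]) (use 3 s1 s2 s3 r t B(2) lh in auto)
  qed
qed

text \<open>The index is the code of a program for \<open>R\<close>. By determinism it returns 0
  exactly where \<open>R\<close> fails, so \<open>\<forall>d. R x a b d\<close> says that no stage
  refutes.\<close>

lemma Pi03_survives:
  assumes "Pi03 A"
  obtains e where "\<And>x. x \<in> A \<longleftrightarrow> (\<forall>a. survives e x a)"
proof -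
  obtain R F where F: "\<And>x a b d. reval F [x, a, b, d] (if R x a b d then 1 else 0)"
    and A: "\<And>x. x \<in> A \<longleftrightarrow> (\<forall>a. \<exists>b. \<forall>d. R x a b d)"
    using assms unfolding Pi03_def recursive_rel4_def by blast
  have "reval F [x, a, b, d] 0 \<longleftrightarrow> \<not> R x a b d" for x a b d
    using F[of x a b d] reval_deterministic[of F "[x, a, b, d]"] by (auto split: if_splits)
  then have "(\<exists>t. refuted (code F) x a b t) \<longleftrightarrow> (\<exists>d. \<not> R x a b d)" for x a b
    by (simp add: ex_refuted_iff)
  then have "(\<forall>t. \<not> refuted (code F) x a b t) \<longleftrightarrow> (\<forall>d. R x a b d)" for x a b
    by blast
  then have "x \<in> A \<longleftrightarrow> (\<forall>a. survives (code F) x a)" for x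
    unfolding survives_def A by (metis order_refl)
  then show thesis by (rule that)
qed

theorem theorem3p11:
  shows "\<exists>c :: nat \<Rightarrow> nat. recursive_fun c \<and> (\<forall>n. c n \<in> {0, 1}) \<and>
    (\<forall>A. A \<subseteq> {0<..} \<and> infinite A \<and> Pi03 A \<and> weak_apart A \<longrightarrow>
       (\<exists>w1\<in>FS A. \<exists>w2\<in>FS A. c w1 \<noteq> c w2))"
proof (intro exI[of _ colour] conjI allI impI)
  show "recursive_fun colour" by (rule recursive_colour)
  show "colour n \<in> {0, 1}" for n by (simp add: colour_def)
  fix A
  assume A: "A \<subseteq> {0<..} \<and> infinite A \<and> Pi03 A \<and> weak_apart A"
  then obtain e where "\<And>x. x \<in> A \<longleftrightarrow> (\<forall>a. survives e x a)" by (metis Pi03_survives)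
  with A show "\<exists>w1\<in>FS A. \<exists>w2\<in>FS A. colour w1 \<noteq> colour w2"
    by (intro weak_apart_refutes_homogeneity[of A e]) auto
qed

end
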